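(* Let $\Phi\subseteq V^*$ be an essential irreducible root system of classical type ($\mathrm A_n$, $\mathrm B_n$, $\mathrm C_n$ or $\mathrm D_n$), let $\Sigma$ be the Euclidean Coxeter complex of type $\Phi$, and $\mathcal V\subseteq V$ its vertex set. For a nonempty set $D\subseteq\mathcal V$, the following are equivalent: (a) $D$ is an L-convex set of type $\Phi$. (b) The subcomplex $\Sigma[D]$ of $\Sigma$ induced by $D$ is a convex subcomplex of $\Sigma$. (c) The Lovász extension $\overline D$ of $D$ is a convex subset of $V$. (d) $\mathcal V(A_{(x+y)/2})\subseteq D$ for all $x,y\in D$.
   Context: Root systems. $V$ is a finite-dimensional real inner product space with dual $V^*$, $\langle p,x\rangle=p(x)$ for $p\in V^*,x\in V$; $V^*$ carries the induced inner product. For $\alpha\in V^*\setminus\{0\}$, $\alpha^\vee\in V$ is $2/\|\alpha\|^2$ times the vector of $V$ representing $\alpha$, and $s_\alpha(p)=p-\langle p,\alpha^\vee\rangle\alpha$. A root system is a nonempty finite set $\Phi\subseteq V^*\setminus\{0\}$ with $s_\alpha(\beta)\in\Phi$, $\mathbb R\alpha\cap\Phi=\{\alpha,-\alpha\}$ and $\langle\alpha,\beta^\vee\rangle\in\mathbb Z$ for all $\alpha,\beta\in\Phi$. It is essential if $\operatorname{span}\Phi=V^*$, and irreducible if it is not a disjoint union of two nonempty mutually orthogonal subsets. Euclidean Coxeter complex. For $(\alpha,k)\in\Phi\times\mathbb Z$ let $H^0_{\alpha,k},H^+_{\alpha,k},H^-_{\alpha,k}$ be the sets of $x\in V$ with $\langle\alpha,x\rangle=k$,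 $>k$, $<k$. An (open) cell is a nonempty set $A=\bigcap_{(\alpha,k)\in\Phi\times\mathbb Z}H^{\sigma_{\alpha,k}(A)}_{\alpha,k}$ with $\sigma_{\alpha,k}(A)\in\{+,0,-\}$ (its sign sequence). $\Sigma$ is the set of all cells together with $\emptyset$ (whose sign sequence is defined to be all $0$), ordered by $A\preceq B\iff\operatorname{cl}A\subseteq\operatorname{cl}B$; it is a simplicial complex, the cells partition $V$, and each nonempty cell $A$ is the relative interior of a geometric simplex, whose vertex set is denoted $\mathcal V(A)$. $\mathcal V$ is the set of vertices (one-point cells, identified with points of $V$). For $x\in V$, $A_x$ is the cell containing $x$. Subcomplexes. A subcomplex is a nonempty subset of $\Sigma$ closed under passing to smaller elements for $\preceq$. For $D\subseteq\mathcal V$, $\Sigma[D]=\{A\in\Sigma:\mathcal V(A)\subseteq D\}$, and the Lovász extension is $\overline D=\bigcup_{A\in\Sigma[D]}A\subseteq V$. The product $AB$ of $A,B\in\Sigma$ is the element of $\Sigma$ with sign sequence $\sigma_{\alpha,k}(AB)=\sigma_{\alpha,k}(A)$ if this is nonzero and $=\sigma_{\alpha,k}(B)$ otherwise; for nonempty $A,B$ it is the cell containing $(1-\varepsilon)a+\varepsilon b$ for $a\in A$, $b\in B$ and all small $\varepsilon>0$. A subcomplex is convex if it is closed under products. A nonempty set $D\subseteq\mathcal V$ is L-convex of type $\Phi$ if it is the vertex set of some convex subcomplex of $\Sigma$; equivalently, if $D=P\cap\mathcal V$ for some integral L-convex polyhedron $P$ of type $\Phi$, i.e. a nonempty set $P=\{x\in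 V:\langle\alpha,x\rangle\le\gamma(\alpha)\ \forall\alpha\in\Phi\}$ with $\gamma:\Phi\to\mathbb Z\cup\{+\infty\}$. *)

theory Defs
  imports "HOL-Analysis.Analysis" "HOL-Analysis.Finite_Function_Topology"
begin

type_synonym 'a dual = "'a \<Rightarrow>\<^sub>L real"

definition riesz :: "'a::euclidean_space dual \<Rightarrow> 'a" where
  "riesz p = (THE v. \<forall>x. blinfun_apply p x = v \<bullet> x)"

definition dual_inner :: "'a::euclidean_space dual \<Rightarrow> 'a dual \<Rightarrow> real" where
  "dual_inner p q = riesz p \<bullet> riesz q"

definition coroot :: "'a::euclidean_space dual \<Rightarrow> 'a" where
  "coroot \<alpha> = (2 / dual_inner \<alpha> \<alpha>) *\<^sub>R riesz \<alpha>"

definition reflection :: "'a::euclidean_space dual \<Rightarrow> 'a dual \<Rightarrow> 'a dual" where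
  "reflection \<alpha> p = p - blinfun_apply p (coroot \<alpha>) *\<^sub>R \<alpha>"

definition root_system :: "'a::euclidean_space dual set \<Rightarrow> bool" where
  "root_system \<Phi> \<longleftrightarrow>
     finite \<Phi> \<and> \<Phi> \<noteq> {} \<and> 0 \<notin> \<Phi> \<and>
     (\<forall>\<alpha>\<in>\<Phi>. \<forall>\<beta>\<in>\<Phi>. reflection \<alpha> \<beta> \<in> \<Phi>) \<and>
     (\<forall>\<alpha>\<in>\<Phi>. range (\<lambda>c. c *\<^sub>R \<alpha>) \<inter> \<Phi> = {\<alpha>, - \<alpha>}) \<and>
     (\<forall>\<alpha>\<in>\<Phi>. \<forall>\<beta>\<in>\<Phi>. blinfun_apply \<alpha> (coroot \<beta>) \<in> \<int>)"

definition essential :: "'a::euclidean_space dual set \<Rightarrow> bool" where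
  "essential \<Phi> \<longleftrightarrow> span \<Phi> = UNIV"

definition irreducible_roots :: "'a::euclidean_space dual set \<Rightarrow> bool" where
  "irreducible_roots \<Phi> \<longleftrightarrow>
     \<not> (\<exists>\<Phi>1 \<Phi>2. \<Phi>1 \<noteq> {} \<and> \<Phi>2 \<noteq> {} \<and> \<Phi>1 \<inter> \<Phi>2 = {} \<and> \<Phi>1 \<union> \<Phi>2 = \<Phi> \<and>
          (\<forall>\<alpha>\<in>\<Phi>1. \<forall>\<beta>\<in>\<Phi>2. dual_inner \<alpha> \<beta> = 0))"

text \<open>
  The standard models live in the space of finitely supported real sequences, so that
  a single ambient space serves all ranks; the model of rank \<open>n\<close> only involves the first
  \<open>n\<close> (for type A: \<open>n + 1\<close>) coordinate vectors.
\<close>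

type_synonym coords = "nat \<Rightarrow>\<^sub>0 real"

definition unit_vec :: "nat \<Rightarrow> coords" where
  "unit_vec i = Poly_Mapping.single i 1"

definition coord_inner :: "coords \<Rightarrow> coords \<Rightarrow> real" where
  "coord_inner u v = (\<Sum>i\<in>Poly_Mapping.keys u. Poly_Mapping.lookup u i * Poly_Mapping.lookup v i)"

definition roots_A :: "nat \<Rightarrow> coords set" where
  "roots_A n = {unit_vec i - unit_vec j | i j. i \<le> n \<and> j \<le> n \<and> i \<noteq> j}"

definition roots_D :: "nat \<Rightarrow> coords set" where
  "roots_D n = {s *\<^sub>R unit_vec i + t *\<^sub>R unit_vec j | s t i j.
                  s \<in> {1, -1} \<and> t \<in> {1, -1} \<and> i < j \<and> j < n}"

definition roots_B :: "nat \<Rightarrow> coords set" where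
  "roots_B n = roots_D n \<union> {s *\<^sub>R unit_vec i | s i. s \<in> {1, -1} \<and> i < n}"

definition roots_C :: "nat \<Rightarrow> coords set" where
  "roots_C n = roots_D n \<union> {s *\<^sub>R unit_vec i | s i. s \<in> {2, -2} \<and> i < n}"

text \<open>
  Isomorphism of root systems: a linear isomorphism of the spans that maps one system onto the
  other and preserves the Cartan integers.  It need not be an isometry, so the scale of
  the inner product is irrelevant.
\<close>

definition root_iso :: "'a::euclidean_space dual set \<Rightarrow> coords set \<Rightarrow> bool" where
  "root_iso \<Phi> M \<longleftrightarrow>
     (\<exists>T. linear T \<and> inj_on T (span \<Phi>) \<and> T ` \<Phi> = M \<and>
        (\<forall>\<alpha>\<in>\<Phi>. \<forall>\<beta>\<in>\<Phi>. blinfun_apply \<alpha> (coroot \<beta>) =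
            2 * coord_inner (T \<alpha>) (T \<beta>) / coord_inner (T \<beta>) (T \<beta>)))"

text \<open>
  The lower bounds on the ranks are the usual ones; the cases left out are either
  reducible (D2), not root systems, or isomorphic to one that is included.
\<close>

definition classical_type :: "'a::euclidean_space dual set \<Rightarrow> bool" where
  "classical_type \<Phi> \<longleftrightarrow>
     (\<exists>n\<ge>1. root_iso \<Phi> (roots_A n)) \<or>
     (\<exists>n\<ge>2. root_iso \<Phi> (roots_B n)) \<or>
     (\<exists>n\<ge>2. root_iso \<Phi> (roots_C n)) \<or>
     (\<exists>n\<ge>3. root_iso \<Phi> (roots_D n))"

datatype sign = Neg | Zero | Pos

fun hyp :: "'a::euclidean_space dual \<Rightarrow> int \<Rightarrow> sign \<Rightarrow> 'a set" where
  "hyp \<alpha> k Zero = {x. blinfun_apply \<alpha> x = of_int k}"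
| "hyp \<alpha> k Pos = {x. blinfun_apply \<alpha> x > of_int k}"
| "hyp \<alpha> k Neg = {x. blinfun_apply \<alpha> x < of_int k}"

definition open_cells :: "'a::euclidean_space dual set \<Rightarrow> 'a set set" where
  "open_cells \<Phi> = {A. A \<noteq> {} \<and> (\<exists>\<sigma>. A = (\<Inter>\<alpha>\<in>\<Phi>. \<Inter>k. hyp \<alpha> k (\<sigma> \<alpha> k)))}"

definition coxeter_complex :: "'a::euclidean_space dual set \<Rightarrow> 'a set set" where
  "coxeter_complex \<Phi> = insert {} (open_cells \<Phi>)"

text \<open>The sign sequence; only meaningful for \<open>\<alpha> \<in> \<Phi>\<close>, where the three sets
  \<open>hyp \<alpha> k s\<close> are disjoint and exactly one of them contains a given open cell.\<close>

definition sign_seq :: "'a::euclidean_space set \<Rightarrow> 'a dual \<Rightarrow> int \<Rightarrow> sign" where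
  "sign_seq A \<alpha> k = (if A = {} then Zero else (THE s. A \<subseteq> hyp \<alpha> k s))"

definition cell_le :: "'a::euclidean_space set \<Rightarrow> 'a set \<Rightarrow> bool" where
  "cell_le A B \<longleftrightarrow> closure A \<subseteq> closure B"

text \<open>An open cell is the relative interior of the simplex \<open>closure A\<close>, whose
  vertices are its extreme points.\<close>

definition cell_vertices :: "'a::euclidean_space set \<Rightarrow> 'a set" where
  "cell_vertices A = {v. v extreme_point_of closure A}"

definition vertices :: "'a::euclidean_space dual set \<Rightarrow> 'a set" where
  "vertices \<Phi> = {v. {v} \<in> open_cells \<Phi>}"

definition cell_at :: "'a::euclidean_space dual set \<Rightarrow> 'a \<Rightarrow> 'a set" where
  "cell_at \<Phi> x = (THE A. A \<in> open_cells \<Phi> \<and> x \<in> A)"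

definition subcomplex :: "'a::euclidean_space dual set \<Rightarrow> 'a set set \<Rightarrow> bool" where
  "subcomplex \<Phi> X \<longleftrightarrow>
     X \<noteq> {} \<and> X \<subseteq> coxeter_complex \<Phi> \<and>
     (\<forall>B\<in>X. \<forall>A\<in>coxeter_complex \<Phi>. cell_le A B \<longrightarrow> A \<in> X)"

definition induced_subcomplex :: "'a::euclidean_space dual set \<Rightarrow> 'a set \<Rightarrow> 'a set set" where
  "induced_subcomplex \<Phi> D = {A \<in> coxeter_complex \<Phi>. cell_vertices A \<subseteq> D}"

definition lovasz_extension :: "'a::euclidean_space dual set \<Rightarrow> 'a set \<Rightarrow> 'a set" where
  "lovasz_extension \<Phi> D = \<Union> (induced_subcomplex \<Phi> D)"

definition cell_prod :: "'a::euclidean_space dual set \<Rightarrow> 'a set \<Rightarrow> 'a set \<Rightarrow> 'a set" where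
  "cell_prod \<Phi> A B =
     (THE C. C \<in> coxeter_complex \<Phi> \<and>
        (\<forall>\<alpha>\<in>\<Phi>. \<forall>k. sign_seq C \<alpha> k =
           (if sign_seq A \<alpha> k \<noteq> Zero then sign_seq A \<alpha> k else sign_seq B \<alpha> k)))"

definition convex_subcomplex :: "'a::euclidean_space dual set \<Rightarrow> 'a set set \<Rightarrow> bool" where
  "convex_subcomplex \<Phi> X \<longleftrightarrow>
     subcomplex \<Phi> X \<and> (\<forall>A\<in>X. \<forall>B\<in>X. cell_prod \<Phi> A B \<in> X)"

definition L_convex :: "'a::euclidean_space dual set \<Rightarrow> 'a set \<Rightarrow> bool" where
  "L_convex \<Phi> D \<longleftrightarrow>
     D \<noteq> {} \<and> D \<subseteq> vertices \<Phi> \<and>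
     (\<exists>X. convex_subcomplex \<Phi> X \<and> D = {v. {v} \<in> X})"

end

theory Submission
  imports Defs
begin

text \<open>
  Everything is expressed by sign vectors: a cell is given by the signs of its points with respect to
  all hyperplanes, the face order and the product of cells are coordinatewise operations, and the
  empty face is the zero vector. A product of two cells is entered when one moves from a point of the
  first a little towards a point of the second.

  The equivalence of L-convexity with convexity of the induced subcomplex holds because every cell is
  the product of its vertices (\<open>closed_family_eq_full_faces\<close>). If the induced subcomplex is closed
  under products, a segment between two points of the Lovasz extension cannot leave it
  (\<open>convex_full_faces\<close>), and a convex Lovasz extension contains the cells of all midpoints. The
  substance is the way back from midpoints to products (\<open>full_faces_closed\<close>). It uses two facts.

  First, cells are simplices: each vertex has an opposite wall (\<open>root_opposite_wall\<close>). For an alcove, the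
  facet normals have pairwise nonpositive inner products, and they cannot be split into two
  orthogonal parts because the root system is irreducible; so any proper subset of them is
  independent. As a consequence, two faces of a common cell with all vertices in \<open>D\<close> have a join with
  all vertices in \<open>D\<close> (\<open>full_faces_join\<close>).

  Second, for the classical types, all roots take values in \<open>1/2\<close> times the integers at the vertices
  (\<open>classical_half_integral\<close>).

  Given vertices \<open>y\<close>, \<open>z\<close> of \<open>D\<close> that are separated by some hyperplane, one looks at the cell of the
  midpoint. Its vertices lie in \<open>D\<close>, and by half-integrality they are separated from \<open>y\<close> by fewer
  hyperplanes than \<open>z\<close> is, except in one special position that calls for a careful choice of the
  vertex and sometimes a second midpoint (\<open>descent\<close>). By induction, the products of \<open>y\<close> with these vertices have all their vertices in \<open>D\<close>, and
  \<open>y z\<close> is a product of such products. These factors all have \<open>y\<close> as a face, so what is needed is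
  closure under products in the star of \<open>y\<close>; hence the statement is proved for the star of each
  face \<open>f\<close>, by downward induction on \<open>f\<close>, ending with the empty face (\<open>star_closed_step\<close>).
\<close>

section \<open>Sign vectors\<close>

text \<open>
  Sign vectors are functions from an index set of hyperplanes to the three signs. The product
  takes the sign of the first factor and uses the second factor only where the first vanishes.
\<close>

definition smul :: "('i \<Rightarrow> sign) \<Rightarrow> ('i \<Rightarrow> sign) \<Rightarrow> 'i \<Rightarrow> sign" where
  "smul s t = (\<lambda>i. if s i \<noteq> Zero then s i else t i)"

text \<open>
  The face order: the first sign vector arises from the second by setting some signs to zero.
\<close>

definition sle :: "('i \<Rightarrow> sign) \<Rightarrow> ('i \<Rightarrow> sign) \<Rightarrow> bool" where
  "sle s t \<longleftrightarrow> (\<forall>i. s i = Zero \<or> s i = t i)"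

text \<open>
  No hyperplane separates the two faces strictly; equivalently, they are faces of a common face.
\<close>

definition compat :: "('i \<Rightarrow> sign) \<Rightarrow> ('i \<Rightarrow> sign) \<Rightarrow> bool" where
  "compat s t \<longleftrightarrow> (\<forall>i. s i = Zero \<or> t i = Zero \<or> s i = t i)"

text \<open>
  The sign vector of the empty face; it is the unit of the product.
\<close>

definition szero :: "'i \<Rightarrow> sign" where
  "szero = (\<lambda>i. Zero)"

text \<open>
  The third face lies in every closed half-space that contains the first two.
\<close>

definition sbetween :: "('i \<Rightarrow> sign) \<Rightarrow> ('i \<Rightarrow> sign) \<Rightarrow> ('i \<Rightarrow> sign) \<Rightarrow> bool" where
  "sbetween s t u \<longleftrightarrow> (\<forall>i. u i = Zero \<or> u i = s i \<or> u i = t i)"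

text \<open>
  The hyperplanes that strictly separate two faces.
\<close>

definition separators :: "('i \<Rightarrow> sign) \<Rightarrow> ('i \<Rightarrow> sign) \<Rightarrow> 'i set" where
  "separators s t = {i. s i \<noteq> Zero \<and> t i \<noteq> Zero \<and> s i \<noteq> t i}"

lemma sle_refl: "sle s s"
  by (simp add: sle_def)

lemma sle_trans: "sle s t \<Longrightarrow> sle t u \<Longrightarrow> sle s u"
  unfolding sle_def by metis

lemma sle_antisym: "sle s t \<Longrightarrow> sle t s \<Longrightarrow> s = t"
  unfolding sle_def by (rule ext) metis

lemma sle_imp_compat: "sle s u \<Longrightarrow> sle t u \<Longrightarrow> compat s t"
  unfolding sle_def compat_def by metis

lemma sle_smul1: "sle s (smul s t)"
  unfolding sle_def smul_def by auto

lemma sle_smul2: "compat s t \<Longrightarrow> sle t (smul s t)"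
  unfolding sle_def smul_def compat_def by metis

lemma smul_least: "sle s u \<Longrightarrow> sle t u \<Longrightarrow> sle (smul s t) u"
  unfolding sle_def smul_def by auto

lemma compat_smul: "compat f s \<Longrightarrow> compat f t \<Longrightarrow> compat f (smul s t)"
  unfolding compat_def smul_def by metis

lemma smul_assoc: "smul (smul s t) u = smul s (smul t u)"
  unfolding smul_def by auto

lemma smul_absorb: "sle s t \<Longrightarrow> smul s t = t"
  unfolding sle_def smul_def by (rule ext) metis

lemma smul_szero [simp]: "smul szero s = s" "smul s szero = s"
  unfolding smul_def szero_def by auto

lemma sbetween_trans: "sbetween s t u \<Longrightarrow> sbetween s u v \<Longrightarrow> sbetween s t v"
  unfolding sbetween_def by metis

lemma sbetween_separators: "sbetween s t u \<Longrightarrow> separators s u \<subseteq> separators s t"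
  unfolding sbetween_def separators_def by auto

lemma sbetween_compat: "compat f s \<Longrightarrow> compat f t \<Longrightarrow> sbetween s t u \<Longrightarrow> compat f u"
  unfolding sbetween_def compat_def by metis

lemma separators_empty_iff: "separators s t = {} \<longleftrightarrow> compat s t"
  unfolding separators_def compat_def by auto

text \<open>
  A set of sign vectors that is closed under products contains \<open>\<rho>\<close> if it contains a face \<open>g\<close> of \<open>\<rho>\<close>
  and, for each of the finitely many coordinates where only \<open>g\<close> vanishes, a face of \<open>\<rho>\<close> that is
  nonzero there: the product of \<open>g\<close> with some of these faces is \<open>\<rho>\<close>.
\<close>

lemma product_cover:
  assumes closed: "\<And>s t. s \<in> G \<Longrightarrow> t \<in> G \<Longrightarrow> smul s t \<in> G"
    and g: "g \<in> G" "sle g \<rho>"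
    and fin: "finite {i. g i = Zero \<and> \<rho> i \<noteq> Zero}"
    and cov: "\<And>i. \<rho> i \<noteq> Zero \<Longrightarrow> g i = Zero \<Longrightarrow> \<exists>x\<in>G. sle x \<rho> \<and> x i \<noteq> Zero"
  shows "\<rho> \<in> G"
  using g fin cov
proof (induction "card {i. g i = Zero \<and> \<rho> i \<noteq> Zero}" arbitrary: g rule: less_induct)
  case less
  show ?case
  proof (cases "{i. g i = Zero \<and> \<rho> i \<noteq> Zero} = {}")
    case True
    then have "g = \<rho>" using less.prems(2) unfolding sle_def by (intro ext) (auto, metis)
    then show ?thesis using less.prems by simp
  next
    case False
    then obtain i where i: "g i = Zero" "\<rho> i \<noteq> Zero" by auto
    then obtain x where x: "x \<in> G" "sle x \<rho>" "x i \<noteq> Zero" using less.prems(4) by metis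
    let ?h = "smul g x"
    have sub: "{j. ?h j = Zero \<and> \<rho> j \<noteq> Zero} \<subset> {i. g i = Zero \<and> \<rho> i \<noteq> Zero}"
      using i x unfolding smul_def by auto
    have "?h \<in> G" using closed less.prems(1) x by blast
    moreover have "sle ?h \<rho>" using smul_least less.prems(2) x by blast
    moreover have "\<exists>x\<in>G. sle x \<rho> \<and> x j \<noteq> Zero" if "\<rho> j \<noteq> Zero" "?h j = Zero" for j
      using that less.prems(4)[of j] unfolding smul_def by (simp split: if_splits)
    moreover have "finite {j. ?h j = Zero \<and> \<rho> j \<noteq> Zero}"
      using sub less.prems(3) finite_subset by blast
    ultimately show ?thesis
      using less.hyps[OF psubset_card_mono[OF less.prems(3) sub]] by blast
  qed
qed

section \<open>Hyperplane arrangements\<close>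

text \<open>
  The sign of a real number.
\<close>

definition rsign :: "real \<Rightarrow> sign" where
  "rsign r = (if r > 0 then Pos else if r < 0 then Neg else Zero)"

text \<open>
  The sign vector of a point \<open>p\<close> for the affine hyperplanes \<open>a \<bullet> x = k\<close> with \<open>a \<in> R\<close> and \<open>k\<close> an
  integer. Linear forms are represented by vectors. Pairs \<open>(a, k)\<close> with \<open>a \<notin> R\<close> get the sign zero,
  so that equality of points in the same cell becomes equality of functions.
\<close>

definition sv :: "'a::euclidean_space set \<Rightarrow> 'a \<Rightarrow> 'a \<times> int \<Rightarrow> sign" where
  "sv R p = (\<lambda>(a, k). if a \<in> R then rsign (a \<bullet> p - of_int k) else Zero)"

text \<open>
  The open cell of a point.
\<close>

definition cell :: "'a::euclidean_space set \<Rightarrow> 'a \<Rightarrow> 'a set" where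
  "cell R p = {x. sv R x = sv R p}"

text \<open>
  The union of the faces of the cell of \<open>p\<close>; it is the closure of that cell (lemma \<open>closure_cell\<close>
  below).
\<close>

definition closed_cell :: "'a::euclidean_space set \<Rightarrow> 'a \<Rightarrow> 'a set" where
  "closed_cell R p = {x. sle (sv R x) (sv R p)}"

text \<open>
  The vertices of the arrangement: the points that form a cell by themselves.
\<close>

definition verts :: "'a::euclidean_space set \<Rightarrow> 'a set" where
  "verts R = {v. cell R v = {v}}"

lemma rsign_simps [simp]:
  "rsign r = Pos \<longleftrightarrow> r > 0" "rsign r = Neg \<longleftrightarrow> r < 0" "rsign r = Zero \<longleftrightarrow> r = 0"
  "Pos = rsign r \<longleftrightarrow> r > 0" "Neg = rsign r \<longleftrightarrow> r < 0" "Zero = rsign r \<longleftrightarrow> r = 0"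
  by (auto simp: rsign_def)

lemma sv_simp: "a \<in> R \<Longrightarrow> sv R p (a, k) = rsign (a \<bullet> p - of_int k)"
  by (simp add: sv_def)

lemma sv_outside: "a \<notin> R \<Longrightarrow> sv R p (a, k) = Zero"
  by (simp add: sv_def)

lemma sv_Zero_iff: "sv R p (a, k) = Zero \<longleftrightarrow> a \<notin> R \<or> a \<bullet> p = of_int k"
  by (simp add: sv_def)

lemma sv_eqI:
  assumes "\<And>a k. a \<in> R \<Longrightarrow> rsign (a \<bullet> p - of_int k) = rsign (a \<bullet> q - of_int k)"
  shows "sv R p = sv R q"
  using assms by (auto simp: sv_def)

lemma sle_sv_iff:
  "sle (sv R p) (sv R q) \<longleftrightarrow>
    (\<forall>a\<in>R. \<forall>k::int. a \<bullet> p = k \<or> rsign (a \<bullet> p - k) = rsign (a \<bullet> q - k))"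
  by (auto simp: sle_def sv_def)

lemma finite_zeros_off_support:
  assumes "finite R" shows "finite {i. sv R p i = Zero \<and> (sv R q i \<noteq> Zero)}"
proof (rule finite_subset)
  show "{i. sv R p i = Zero \<and> (sv R q i \<noteq> Zero)} \<subseteq> (\<lambda>a. (a, \<lfloor>a \<bullet> p\<rfloor>)) ` R"
    by (auto simp: sv_Zero_iff image_iff)
qed (use assms in auto)

text \<open>
  A finite, symmetric and spanning set \<open>R\<close> of normal vectors. Symmetry makes it possible to work
  with upper bounds only; spanning makes the cells bounded.
\<close>

locale arrangement =
  fixes R :: "'a::euclidean_space set"
  assumes finite_R: "finite R"
    and minus_R: "a \<in> R \<Longrightarrow> - a \<in> R"
    and span_R: "span R = UNIV"
begin

lemma closed_cell_le: "x \<in> closed_cell R p \<longleftrightarrow> (\<forall>a\<in>R. a \<bullet> x \<le> of_int \<lceil>a \<bullet> p\<rceil>)"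
proof
  assume x: "x \<in> closed_cell R p"
  show "\<forall>a\<in>R. a \<bullet> x \<le> of_int \<lceil>a \<bullet> p\<rceil>"
  proof (rule ballI, rule ccontr)
    fix a assume a: "a \<in> R" "\<not> a \<bullet> x \<le> of_int \<lceil>a \<bullet> p\<rceil>"
    have "a \<bullet> x = of_int \<lceil>a \<bullet> p\<rceil> \<or>
        rsign (a \<bullet> x - of_int \<lceil>a \<bullet> p\<rceil>) = rsign (a \<bullet> p - of_int \<lceil>a \<bullet> p\<rceil>)"
      using x a(1) unfolding closed_cell_def mem_Collect_eq sle_sv_iff by blast
    then have "rsign (a \<bullet> x - of_int \<lceil>a \<bullet> p\<rceil>) = rsign (a \<bullet> p - of_int \<lceil>a \<bullet> p\<rceil>)"
      using a by auto
    moreover have "rsign (a \<bullet> x - of_int \<lceil>a \<bullet> p\<rceil>) = Pos" using a by simp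
    ultimately have "a \<bullet> p > of_int \<lceil>a \<bullet> p\<rceil>" by simp
    then show False by linarith
  qed
next
  assume *: "\<forall>a\<in>R. a \<bullet> x \<le> of_int \<lceil>a \<bullet> p\<rceil>"
  show "x \<in> closed_cell R p"
    unfolding closed_cell_def mem_Collect_eq sle_sv_iff
  proof (intro ballI allI)
    fix a and k :: int assume a: "a \<in> R"
    have 1: "a \<bullet> x \<le> of_int \<lceil>a \<bullet> p\<rceil>" and "(-a) \<bullet> x \<le> of_int \<lceil>(-a) \<bullet> p\<rceil>" using * a minus_R by blast+
    then have 2: "a \<bullet> x \<ge> of_int \<lfloor>a \<bullet> p\<rfloor>" by (simp add: ceiling_minus)
    consider "a \<bullet> p = k" | "a \<bullet> p < k" | "a \<bullet> p > k" by linarith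
    then show "a \<bullet> x = k \<or> rsign (a \<bullet> x - k) = rsign (a \<bullet> p - k)"
    proof cases
      case 1 then show ?thesis using \<open>a \<bullet> x \<le> of_int \<lceil>a \<bullet> p\<rceil>\<close> 2 by auto
    next
      case c: 2
      then have "\<lceil>a \<bullet> p\<rceil> \<le> k" by (simp add: ceiling_le_iff)
      then have "a \<bullet> x \<le> k" using 1 by linarith
      then show ?thesis using c by (cases "a \<bullet> x = k") (auto simp: rsign_def)
    next
      case c: 3
      then have "\<lfloor>a \<bullet> p\<rfloor> \<ge> k" by linarith
      then have "a \<bullet> x \<ge> k" using 2 by linarith
      then show ?thesis using c by (cases "a \<bullet> x = k") (auto simp: rsign_def)
    qed
  qed
qed

lemma closed_cell_bounds:
  assumes "x \<in> closed_cell R p" "a \<in> R"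
  shows "a \<bullet> x \<le> of_int \<lceil>a \<bullet> p\<rceil>" "of_int \<lfloor>a \<bullet> p\<rfloor> \<le> a \<bullet> x"
proof -
  show "a \<bullet> x \<le> of_int \<lceil>a \<bullet> p\<rceil>" using assms closed_cell_le by blast
  have "(-a) \<bullet> x \<le> of_int \<lceil>(-a) \<bullet> p\<rceil>" using assms closed_cell_le minus_R by blast
  then show "of_int \<lfloor>a \<bullet> p\<rfloor> \<le> a \<bullet> x" by (simp add: ceiling_minus)
qed

lemma closed_cell_halfspaces: "closed_cell R p = (\<Inter>a\<in>R. {x. a \<bullet> x \<le> of_int \<lceil>a \<bullet> p\<rceil>})"
  using closed_cell_le by auto

lemma closed_closed_cell: "closed (closed_cell R p)"
  unfolding closed_cell_halfspaces by (intro closed_INT ballI closed_halfspace_le)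

lemma convex_closed_cell: "convex (closed_cell R p)"
  unfolding closed_cell_halfspaces by (intro convex_INT convex_halfspace_le)

lemma bounded_if_roots_bounded:
  assumes "\<And>a. a \<in> R \<Longrightarrow> \<exists>M. \<forall>x\<in>S. \<bar>a \<bullet> x\<bar> \<le> M"
  shows "bounded S"
proof -
  let ?W = "{a. \<exists>M. \<forall>x\<in>S. \<bar>a \<bullet> x\<bar> \<le> M}"
  have "subspace ?W"
  proof (rule subspaceI)
    show "0 \<in> ?W" by auto
    show "a + b \<in> ?W" if ab: "a \<in> ?W" "b \<in> ?W" for a b
    proof -
      obtain M N where "\<forall>x\<in>S. \<bar>a \<bullet> x\<bar> \<le> M" "\<forall>x\<in>S. \<bar>b \<bullet> x\<bar> \<le> N"
        using ab by blast
      then have "\<forall>x\<in>S. \<bar>(a + b) \<bullet> x\<bar> \<le> M + N" by (force simp: inner_add_left)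
      then show ?thesis by blast
    qed
    show "c *\<^sub>R a \<in> ?W" if a: "a \<in> ?W" for c a
    proof -
      obtain M where "\<forall>x\<in>S. \<bar>a \<bullet> x\<bar> \<le> M" using a by auto
      then have "\<forall>x\<in>S. \<bar>(c *\<^sub>R a) \<bullet> x\<bar> \<le> \<bar>c\<bar> * M" by (auto simp: abs_mult mult_left_mono)
      then show ?thesis by blast
    qed
  qed
  moreover have "R \<subseteq> ?W" using assms by auto
  ultimately have "span R \<subseteq> ?W" by (rule span_minimal[rotated])
  then have "\<forall>b::'a. \<exists>M. \<forall>x\<in>S. \<bar>b \<bullet> x\<bar> \<le> M" using span_R by auto
  then obtain M where M: "\<And>b x. x \<in> S \<Longrightarrow> \<bar>b \<bullet> x\<bar> \<le> M b" by metis
  show ?thesis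
    unfolding bounded_iff
  proof (intro exI ballI)
    fix x assume x: "x \<in> S"
    have "norm x \<le> (\<Sum>b\<in>Basis. \<bar>x \<bullet> b\<bar>)" by (rule norm_le_l1)
    also have "\<dots> \<le> (\<Sum>b\<in>Basis. M b)" using M[OF x] by (intro sum_mono) (simp add: inner_commute)
    finally show "norm x \<le> (\<Sum>b\<in>Basis. M b)" .
  qed
qed

lemma bounded_closed_cell: "bounded (closed_cell R p)"
proof (rule bounded_if_roots_bounded)
  fix a assume a: "a \<in> R"
  have "\<bar>a \<bullet> x\<bar> \<le> \<bar>of_int \<lceil>a \<bullet> p\<rceil>\<bar> + \<bar>of_int \<lfloor>a \<bullet> p\<rfloor>\<bar>" if "x \<in> closed_cell R p" for x
    using closed_cell_bounds[OF that a] by linarith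
  then show "\<exists>M. \<forall>x\<in>closed_cell R p. \<bar>a \<bullet> x\<bar> \<le> M" by blast
qed

lemma compact_closed_cell: "compact (closed_cell R p)"
  by (simp add: compact_eq_bounded_closed bounded_closed_cell closed_closed_cell)

lemma no_recession_direction:
  assumes "\<And>t. t \<ge> 0 \<Longrightarrow> x + t *\<^sub>R w \<in> closed_cell R p"
  shows "w = 0"
proof (rule ccontr)
  assume w: "w \<noteq> 0"
  obtain M where M: "\<And>y. y \<in> closed_cell R p \<Longrightarrow> norm y \<le> M"
    using bounded_closed_cell bounded_iff by metis
  let ?t = "(\<bar>M\<bar> + norm x + 1) / norm w"
  have "norm (?t *\<^sub>R w) = \<bar>M\<bar> + norm x + 1" using w by simp
  moreover have "norm (?t *\<^sub>R w) \<le> norm (x + ?t *\<^sub>R w) + norm x"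
    by (metis add.commute add_diff_cancel_left' norm_triangle_ineq4)
  moreover have "norm (x + ?t *\<^sub>R w) \<le> M" using M assms by simp
  ultimately show False by linarith
qed

text \<open>Local finiteness: all cells near \<open>p\<close> have the cell of \<open>p\<close> as a face.\<close>

lemma eventually_sle: "eventually (\<lambda>x. sle (sv R p) (sv R x)) (nhds p)"
proof -
  have "\<forall>a\<in>R. eventually (\<lambda>x. of_int \<lceil>a \<bullet> p\<rceil> - 1 < a \<bullet> x \<and> a \<bullet> x < of_int \<lfloor>a \<bullet> p\<rfloor> + 1) (nhds p)"
  proof
    fix a assume "a \<in> R"
    have t: "((\<lambda>x. a \<bullet> x) \<longlongrightarrow> a \<bullet> p) (nhds p)" by (intro tendsto_intros filterlim_ident)
    show "eventually (\<lambda>x. of_int \<lceil>a \<bullet> p\<rceil> - 1 < a \<bullet> x \<and> a \<bullet> x < of_int \<lfloor>a \<bullet> p\<rfloor> + 1) (nhds p)"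
      by (intro eventually_conj order_tendstoD[OF t]) linarith+
  qed
  then have "eventually (\<lambda>x. \<forall>a\<in>R. of_int \<lceil>a \<bullet> p\<rceil> - 1 < a \<bullet> x \<and> a \<bullet> x < of_int \<lfloor>a \<bullet> p\<rfloor> + 1) (nhds p)"
    by (simp add: eventually_ball_finite_distrib finite_R)
  then show ?thesis
  proof (rule eventually_mono)
    fix x assume *: "\<forall>a\<in>R. of_int \<lceil>a \<bullet> p\<rceil> - 1 < a \<bullet> x \<and> a \<bullet> x < of_int \<lfloor>a \<bullet> p\<rfloor> + 1"
    show "sle (sv R p) (sv R x)"
      unfolding sle_sv_iff
    proof (intro ballI allI)
      fix a and k :: int assume a: "a \<in> R"
      note b = *[rule_format, OF a]
      consider "a \<bullet> p = k" | "a \<bullet> p < k" | "a \<bullet> p > k" by linarith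
      then show "a \<bullet> p = k \<or> rsign (a \<bullet> p - k) = rsign (a \<bullet> x - k)"
      proof cases
        case 2
        then have "\<lfloor>a \<bullet> p\<rfloor> + 1 \<le> k" by linarith
        then have "a \<bullet> x < k" using b by linarith
        then show ?thesis using 2 by (auto simp: rsign_def)
      next
        case 3
        then have "k \<le> \<lceil>a \<bullet> p\<rceil> - 1" by linarith
        then have "a \<bullet> x > k" using b by linarith
        then show ?thesis using 3 by (auto simp: rsign_def)
      qed auto
    qed
  qed
qed

text \<open>
  On a ray that starts at \<open>p\<close>, the signs near \<open>p\<close> are those of \<open>p\<close>, except on hyperplanes through \<open>p\<close>,
  where they are those of the direction.
\<close>

lemma eventually_sv_ray:
  "eventually (\<lambda>\<epsilon>. \<forall>a\<in>R. \<forall>k::int. rsign (a \<bullet> (p + \<epsilon> *\<^sub>R w) - k) =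
      (if a \<bullet> p = k then rsign (a \<bullet> w) else rsign (a \<bullet> p - k))) (at_right 0)"
proof -
  have "((\<lambda>\<epsilon>. p + \<epsilon> *\<^sub>R w) \<longlongrightarrow> p + 0 *\<^sub>R w) (at_right 0)"
    by (intro tendsto_intros)
  then have "filterlim (\<lambda>\<epsilon>. p + \<epsilon> *\<^sub>R w) (nhds p) (at_right 0)" by simp
  from eventually_compose_filterlim[OF eventually_sle this]
  have "eventually (\<lambda>\<epsilon>. sle (sv R p) (sv R (p + \<epsilon> *\<^sub>R w))) (at_right 0)" .
  moreover have "eventually (\<lambda>\<epsilon>::real. \<epsilon> > 0) (at_right 0)"
    by (simp add: eventually_at_filter)
  ultimately show ?thesis
  proof eventually_elim
    case (elim \<epsilon>)
    show ?case
    proof (intro ballI allI)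
      fix a and k :: int assume a: "a \<in> R"
      have "a \<bullet> p = k \<or> rsign (a \<bullet> p - k) = rsign (a \<bullet> (p + \<epsilon> *\<^sub>R w) - k)"
        using elim(1) a unfolding sle_sv_iff by blast
      then show "rsign (a \<bullet> (p + \<epsilon> *\<^sub>R w) - k) =
          (if a \<bullet> p = k then rsign (a \<bullet> w) else rsign (a \<bullet> p - k))"
        using elim(2) by (cases "a \<bullet> p = k")
          (auto simp: inner_add_right rsign_def zero_less_mult_iff mult_less_0_iff)
    qed
  qed
qed

lemma sv_ray_ex:
  assumes "0 < d"
  shows "\<exists>e>0. e < d \<and> (\<forall>a\<in>R. \<forall>k::int. rsign (a \<bullet> (p + e *\<^sub>R w) - k) =
      (if a \<bullet> p = k then rsign (a \<bullet> w) else rsign (a \<bullet> p - k)))"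
proof -
  obtain b where b: "b > 0" "\<forall>e>0. e < b \<longrightarrow> (\<forall>a\<in>R. \<forall>k::int. rsign (a \<bullet> (p + e *\<^sub>R w) - k) =
      (if a \<bullet> p = k then rsign (a \<bullet> w) else rsign (a \<bullet> p - k)))"
    using eventually_sv_ray[of p w] unfolding eventually_at_right_field by auto
  obtain e where "0 < e" "e < b" "e < d" using field_lbound_gt_zero b(1) assms by metis
  then show ?thesis using b(2) by blast
qed

text \<open>
  Moving from \<open>p\<close> a little towards \<open>q\<close> leads into the product of the two cells.
\<close>

lemma product_point:
  assumes "0 < d"
  shows "\<exists>e>0. e < d \<and> sv R (p + e *\<^sub>R (q - p)) = smul (sv R p) (sv R q)"
proof -
  obtain e where e: "e > 0" "e < d" "\<forall>a\<in>R. \<forall>k::int. rsign (a \<bullet> (p + e *\<^sub>R (q - p)) - k) =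
      (if a \<bullet> p = k then rsign (a \<bullet> (q - p)) else rsign (a \<bullet> p - k))"
    using sv_ray_ex[OF assms, of p "q - p"] by blast
  have "sv R (p + e *\<^sub>R (q - p)) = smul (sv R p) (sv R q)"
  proof (rule ext)
    fix i :: "'a \<times> int"
    obtain a k where i: "i = (a, k)" by (cases i)
    show "sv R (p + e *\<^sub>R (q - p)) i = smul (sv R p) (sv R q) i"
      unfolding i using e(3) by (cases "a \<in> R") (auto simp: sv_def smul_def inner_diff_right)
  qed
  then show ?thesis using e by blast
qed

lemma closure_cell: "closure (cell R p) = closed_cell R p"
proof
  show "closure (cell R p) \<subseteq> closed_cell R p"
    by (rule closure_minimal[OF _ closed_closed_cell]) (auto simp: cell_def closed_cell_def sle_refl)
  show "closed_cell R p \<subseteq> closure (cell R p)"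
  proof
    fix x assume x: "x \<in> closed_cell R p"
    show "x \<in> closure (cell R p)"
      unfolding closure_approachable
    proof (intro allI impI)
      fix d :: real assume d: "d > 0"
      obtain e where e: "e > 0" "e < d / (norm (p - x) + 1)"
         "sv R (x + e *\<^sub>R (p - x)) = smul (sv R x) (sv R p)"
        using product_point[of "d / (norm (p - x) + 1)" x p] d
        by (metis add_nonneg_pos divide_pos_pos norm_ge_zero zero_less_one)
      have "sv R (x + e *\<^sub>R (p - x)) = sv R p"
        using e x smul_absorb unfolding closed_cell_def by auto
      moreover have "dist (x + e *\<^sub>R (p - x)) x < d"
      proof -
        have "dist (x + e *\<^sub>R (p - x)) x = e * norm (p - x)" using e by (simp add: dist_norm)
        also have "\<dots> \<le> e * (norm (p - x) + 1)" using e by simp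
        also have "\<dots> < d" using e(2) by (simp add: pos_less_divide_eq add_nonneg_pos)
        finally show ?thesis .
      qed
      ultimately show "\<exists>y\<in>cell R p. dist y x < d" unfolding cell_def by blast
    qed
  qed
qed

text \<open>
  A vertex is determined by the hyperplanes through it.
\<close>

lemma vertex_rigid:
  assumes "v \<in> verts R" "\<And>a. a \<in> R \<Longrightarrow> a \<bullet> v \<in> \<int> \<Longrightarrow> a \<bullet> w = 0"
  shows "w = 0"
proof -
  obtain e where e: "e > 0" "\<forall>a\<in>R. \<forall>k::int. rsign (a \<bullet> (v + e *\<^sub>R w) - k) =
      (if a \<bullet> v = k then rsign (a \<bullet> w) else rsign (a \<bullet> v - k))"
    using sv_ray_ex[of 1 v w] by auto
  have "sv R (v + e *\<^sub>R w) = sv R v"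
  proof (rule sv_eqI)
    fix a and k :: int assume a: "a \<in> R"
    show "rsign (a \<bullet> (v + e *\<^sub>R w) - k) = rsign (a \<bullet> v - k)"
    proof (cases "a \<bullet> v = k")
      case True
      then have "a \<bullet> w = 0" using assms(2)[OF a] by simp
      then show ?thesis by (simp add: inner_add_right)
    next
      case False then show ?thesis using e(2) a by auto
    qed
  qed
  then have "v + e *\<^sub>R w = v" using assms(1) unfolding verts_def cell_def by blast
  then show ?thesis using e by simp
qed

lemma vertex_sle_eq:
  assumes "v \<in> verts R" "sle (sv R u) (sv R v)"
  shows "u = v"
proof -
  have "v - u = 0"
  proof (rule vertex_rigid[OF assms(1)])
    fix a assume a: "a \<in> R" "a \<bullet> v \<in> \<int>"
    then obtain k :: int where k: "a \<bullet> v = k" by (auto elim: Ints_cases)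
    have "a \<bullet> u = k \<or> rsign (a \<bullet> u - k) = rsign (a \<bullet> v - k)"
      using assms(2) a(1) unfolding sle_sv_iff by blast
    then have "a \<bullet> u = k" using k by (auto simp: rsign_def split: if_splits)
    then show "a \<bullet> (v - u) = 0" using k by (simp add: inner_diff_right)
  qed
  then show ?thesis by simp
qed

lemma extreme_point_imp_vertex:
  assumes "v extreme_point_of closed_cell R p"
  shows "v \<in> verts R"
proof -
  have v: "v \<in> closed_cell R p" using assms extreme_point_of_def by blast
  have "w = v" if w: "sv R w = sv R v" for w
  proof (rule ccontr)
    assume ne: "w \<noteq> v"
    obtain e where e: "e > 0" "\<forall>a\<in>R. \<forall>k::int. rsign (a \<bullet> (v + e *\<^sub>R (v - w)) - k) =
      (if a \<bullet> v = k then rsign (a \<bullet> (v - w)) else rsign (a \<bullet> v - k))"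
      using sv_ray_ex[of 1 v "v - w"] by auto
    let ?u = "v + e *\<^sub>R (v - w)"
    have "sv R ?u = sv R v"
    proof (rule sv_eqI)
      fix a and k :: int assume a: "a \<in> R"
      show "rsign (a \<bullet> (v + e *\<^sub>R (v - w)) - k) = rsign (a \<bullet> v - k)"
      proof (cases "a \<bullet> v = k")
        case True
        have "sv R w (a, k) = Zero" using w True by (simp add: sv_Zero_iff)
        then show ?thesis using a True by (simp add: sv_Zero_iff inner_add_right inner_diff_right)
      next
        case False then show ?thesis using e(2) a by auto
      qed
    qed
    then have "?u \<in> closed_cell R p" "w \<in> closed_cell R p"
      using v w unfolding closed_cell_def by auto
    moreover have "v \<in> open_segment ?u w"
      unfolding in_segment
    proof (intro conjI exI)
      show "?u \<noteq> w"
      proof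
        assume "?u = w"
        then have "(1 + e) *\<^sub>R (v - w) = 0" by (simp add: algebra_simps)
        then show False using e ne by simp
      qed
      show "0 < e / (1 + e)" "e / (1 + e) < 1" using e by auto
      define t where "t = e / (1 + e)"
      have "(1 - t) * e - t = 0" unfolding t_def using e by (simp add: field_simps)
      moreover have "(1 - t) *\<^sub>R (v + e *\<^sub>R (v - w)) + t *\<^sub>R w = v + ((1 - t) * e - t) *\<^sub>R (v - w)"
        by (simp add: algebra_simps)
      ultimately show "v = (1 - e / (1 + e)) *\<^sub>R (v + e *\<^sub>R (v - w)) + (e / (1 + e)) *\<^sub>R w"
        unfolding t_def[symmetric] by simp
    qed
    ultimately show False using assms unfolding extreme_point_of_def by blast
  qed
  then show ?thesis unfolding verts_def cell_def by auto
qed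

lemma vertex_imp_extreme_point:
  assumes "v \<in> verts R" "sle (sv R v) (sv R p)"
  shows "v extreme_point_of closed_cell R p"
  unfolding extreme_point_of_def
proof (intro conjI ballI)
  show "v \<in> closed_cell R p" using assms unfolding closed_cell_def by simp
  fix x y assume xy: "x \<in> closed_cell R p" "y \<in> closed_cell R p"
  show "v \<notin> open_segment x y"
  proof
    assume "v \<in> open_segment x y"
    then obtain t where t: "x \<noteq> y" "0 < t" "t < 1" "v = (1 - t) *\<^sub>R x + t *\<^sub>R y"
      unfolding in_segment by auto
    have "y - x = 0"
    proof (rule vertex_rigid[OF assms(1)])
      fix a assume a: "a \<in> R" "a \<bullet> v \<in> \<int>"
      then obtain k :: int where k: "a \<bullet> v = k" by (auto elim: Ints_cases)
      have *: "(1 - t) * (a \<bullet> x - k) + t * (a \<bullet> y - k) = 0"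
        using k t(4) by (simp add: inner_add_right algebra_simps)
      have x: "a \<bullet> x = k \<or> rsign (a \<bullet> x - k) = rsign (a \<bullet> p - k)"
       and y: "a \<bullet> y = k \<or> rsign (a \<bullet> y - k) = rsign (a \<bullet> p - k)"
        using xy a(1) unfolding closed_cell_def mem_Collect_eq sle_sv_iff by blast+
      consider "a \<bullet> p = k" | "a \<bullet> p < k" | "a \<bullet> p > k" by linarith
      then have "a \<bullet> x = k \<and> a \<bullet> y = k"
      proof cases
        case 1 then show ?thesis using x y by (auto simp: rsign_def split: if_splits)
      next
        case 2
        then have "a \<bullet> x - k \<le> 0" "a \<bullet> y - k \<le> 0" using x y by (auto simp: rsign_def split: if_splits)
        then have "(1 - t) * (a \<bullet> x - k) \<le> 0" "t * (a \<bullet> y - k) \<le> 0"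
          using t by (auto simp: mult_nonneg_nonpos)
        then have "(1 - t) * (a \<bullet> x - k) = 0" "t * (a \<bullet> y - k) = 0" using * by linarith+
        then show ?thesis using t by simp
      next
        case 3
        then have "a \<bullet> x - k \<ge> 0" "a \<bullet> y - k \<ge> 0" using x y by (auto simp: rsign_def split: if_splits)
        then have "(1 - t) * (a \<bullet> x - k) \<ge> 0" "t * (a \<bullet> y - k) \<ge> 0"
          using t by auto
        then have "(1 - t) * (a \<bullet> x - k) = 0" "t * (a \<bullet> y - k) = 0" using * by linarith+
        then show ?thesis using t by simp
      qed
      then show "a \<bullet> (y - x) = 0" by (simp add: inner_diff_right)
    qed
    then show False using t by simp
  qed
qed

lemma extreme_points_closed_cell:
  "v extreme_point_of closed_cell R p \<longleftrightarrow> v \<in> verts R \<and> sle (sv R v) (sv R p)"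
proof
  assume v: "v extreme_point_of closed_cell R p"
  then have "v \<in> closed_cell R p" unfolding extreme_point_of_def by simp
  then show "v \<in> verts R \<and> sle (sv R v) (sv R p)"
    using extreme_point_imp_vertex[OF v] unfolding closed_cell_def by simp
qed (use vertex_imp_extreme_point in blast)

text \<open>
  By the Krein--Milman theorem, a closed cell is the convex hull of its vertices. Hence an affine
  function that is positive at a point is positive at some vertex of the cell of that point, and
  each nonzero sign of a cell is attained at one of its vertices.
\<close>

lemma closed_cell_hull:
  assumes "x \<in> closed_cell R p"
  shows "x \<in> convex hull {v \<in> verts R. sle (sv R v) (sv R p)}"
  using Krein_Milman_Minkowski[OF compact_closed_cell convex_closed_cell] assms
  by (simp add: extreme_points_closed_cell)

lemma vertex_above:
  assumes "a \<bullet> p > c"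
  shows "\<exists>v\<in>verts R. sle (sv R v) (sv R p) \<and> a \<bullet> v > c"
proof (rule ccontr)
  assume "\<not> ?thesis"
  then have "{v \<in> verts R. sle (sv R v) (sv R p)} \<subseteq> {x. a \<bullet> x \<le> c}" by force
  then have "convex hull {v \<in> verts R. sle (sv R v) (sv R p)} \<subseteq> {x. a \<bullet> x \<le> c}"
    by (rule hull_minimal) (rule convex_halfspace_le)
  moreover have "p \<in> closed_cell R p" by (simp add: closed_cell_def sle_refl)
  ultimately show False using closed_cell_hull assms by force
qed

lemma vertex_support:
  assumes "sv R p i \<noteq> Zero"
  shows "\<exists>v\<in>verts R. sle (sv R v) (sv R p) \<and> sv R v i \<noteq> Zero"
proof -
  obtain a k where i: "i = (a, k)" by (cases i)
  have a: "a \<in> R" "a \<bullet> p \<noteq> k" using assms i sv_Zero_iff by blast+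
  show ?thesis
  proof (cases "a \<bullet> p > k")
    case True
    from vertex_above[OF True] show ?thesis using a i by (force simp: sv_Zero_iff)
  next
    case False
    then have "(-a) \<bullet> p > - k" using a by simp
    from vertex_above[OF this] show ?thesis using a i by (force simp: sv_Zero_iff)
  qed
qed

lemma finite_separators: "finite (separators (sv R p) (sv R q))"
proof (rule finite_subset)
  show "separators (sv R p) (sv R q) \<subseteq>
     (SIGMA a:R. {\<lfloor>- \<bar>a \<bullet> p\<bar> - \<bar>a \<bullet> q\<bar>\<rfloor> .. \<lceil>\<bar>a \<bullet> p\<bar> + \<bar>a \<bullet> q\<bar>\<rceil>})"
  proof
    fix i assume i: "i \<in> separators (sv R p) (sv R q)"
    obtain a k where ak: "i = (a, k)" by (cases i)
    have a: "a \<in> R" using i ak unfolding separators_def by (auto simp: sv_Zero_iff)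
    have "(a \<bullet> p < k \<and> k < a \<bullet> q) \<or> (a \<bullet> q < k \<and> k < a \<bullet> p)"
      using i a unfolding ak separators_def by (auto simp: sv_simp rsign_def split: if_splits)
    then have "- \<bar>a \<bullet> p\<bar> - \<bar>a \<bullet> q\<bar> \<le> k" "k \<le> \<bar>a \<bullet> p\<bar> + \<bar>a \<bullet> q\<bar>" by linarith+
    then have "\<lfloor>- \<bar>a \<bullet> p\<bar> - \<bar>a \<bullet> q\<bar>\<rfloor> \<le> k" "k \<le> \<lceil>\<bar>a \<bullet> p\<bar> + \<bar>a \<bullet> q\<bar>\<rceil>" by linarith+
    then show "i \<in> (SIGMA a:R. {\<lfloor>- \<bar>a \<bullet> p\<bar> - \<bar>a \<bullet> q\<bar>\<rfloor> .. \<lceil>\<bar>a \<bullet> p\<bar> + \<bar>a \<bullet> q\<bar>\<rceil>})" using ak a by simp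
  qed
qed (use finite_R in auto)

end

section \<open>Midpoint-closed vertex sets in a simplicial arrangement\<close>

text \<open>
  The discrete midpoint convexity of a set of vertices: for \<open>x\<close>, \<open>y\<close> in the set, it contains all
  vertices of the cell of the midpoint of \<open>x\<close> and \<open>y\<close>.
\<close>

definition midpoint_closed :: "'a::euclidean_space set \<Rightarrow> 'a set \<Rightarrow> bool" where
  "midpoint_closed R D \<longleftrightarrow>
    (\<forall>x\<in>D. \<forall>y\<in>D. \<forall>v\<in>verts R. sle (sv R v) (sv R ((1/2) *\<^sub>R (x + y))) \<longrightarrow> v \<in> D)"

text \<open>
  The sign vectors of all cells, together with that of the empty face.
\<close>

definition faces :: "'a::euclidean_space set \<Rightarrow> ('a \<times> int \<Rightarrow> sign) set" where
  "faces R = insert szero (range (sv R))"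

text \<open>
  The sign vectors of the faces all of whose vertices lie in \<open>D\<close>.
\<close>

definition full_faces :: "'a::euclidean_space set \<Rightarrow> 'a set \<Rightarrow> ('a \<times> int \<Rightarrow> sign) set" where
  "full_faces R D = {s \<in> faces R. \<forall>v\<in>verts R. sle (sv R v) s \<longrightarrow> v \<in> D}"

text \<open>
  The two properties of the arrangement on which the proof rests. The first one says that the cells
  are simplices: each vertex \<open>v\<close> of a cell has an opposite wall, i.e. a hyperplane that avoids \<open>v\<close>
  and contains all other vertices of the cell. The second one says that every root takes only
  half-integral values at the vertices; it is here that the type of the root system matters.
\<close>

locale simplicial_arrangement = arrangement +
  assumes opposite_wall: "\<lbrakk>v \<in> verts R; sle (sv R v) (sv R p)\<rbrakk> \<Longrightarrow>
      \<exists>i. sv R v i \<noteq> Zero \<and> (\<forall>u\<in>verts R. sle (sv R u) (sv R p) \<longrightarrow> u \<noteq> v \<longrightarrow> sv R u i = Zero)"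
    and half_integral: "\<lbrakk>v \<in> verts R; a \<in> R\<rbrakk> \<Longrightarrow> 2 * (a \<bullet> v) \<in> \<int>"
begin

text \<open>
  The exceptional position of two vertices: every hyperplane \<open>a \<bullet> x = k\<close> that separates them
  strictly passes at distance \<open>1/2\<close> from \<open>y\<close> and \<open>1\<close> from \<open>z\<close>, measured by \<open>a\<close>. In all other positions,
  each vertex of the cell of the midpoint is separated from \<open>y\<close> by fewer hyperplanes than \<open>z\<close> is
  (lemma \<open>not_stuck_rank\<close>).
\<close>

definition stuck :: "'a \<Rightarrow> 'a \<Rightarrow> bool" where
  "stuck y z \<longleftrightarrow> (\<forall>a\<in>R. \<forall>k::int. a \<bullet> y < k \<and> k < a \<bullet> z \<longrightarrow> a \<bullet> y = k - 1/2 \<and> a \<bullet> z = of_int k + 1)"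

text \<open>
  The induction measure for pairs of vertices: the number of separating hyperplanes, and for equal
  numbers the stuck pairs come last.
\<close>

definition rank :: "'a \<Rightarrow> 'a \<Rightarrow> nat" where
  "rank y z = 2 * card (separators (sv R y) (sv R z)) + (if stuck y z then 1 else 0)"

lemma midpoint_sbetween:
  assumes "sle (sv R v) (sv R ((1/2) *\<^sub>R (y + z)))"
  shows "sbetween (sv R y) (sv R z) (sv R v)"
  unfolding sbetween_def
proof
  fix i :: "'a \<times> int"
  obtain a k where i: "i = (a, k)" by (cases i)
  show "sv R v i = Zero \<or> sv R v i = sv R y i \<or> sv R v i = sv R z i"
  proof (cases "a \<in> R")
    case True
    have "a \<bullet> v = k \<or> rsign (a \<bullet> v - k) = rsign (a \<bullet> ((1/2) *\<^sub>R (y + z)) - k)"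
      using assms True unfolding sle_sv_iff by blast
    then show ?thesis
      using True unfolding i by (auto simp: sv_simp inner_add_right rsign_def split: if_splits)
  qed (simp add: i sv_outside)
qed

lemma separatorsD:
  assumes "(a, k) \<in> separators (sv R y) (sv R z)"
  shows "a \<in> R" "(a \<bullet> y < k \<and> k < a \<bullet> z) \<or> (a \<bullet> z < k \<and> k < a \<bullet> y)"
proof -
  show "a \<in> R" using assms unfolding separators_def by (auto simp: sv_Zero_iff)
  then show "(a \<bullet> y < k \<and> k < a \<bullet> z) \<or> (a \<bullet> z < k \<and> k < a \<bullet> y)"
    using assms unfolding separators_def by (auto simp: sv_simp rsign_def split: if_splits)
qed

lemma separatorsI:
  assumes "a \<in> R" "a \<bullet> y < of_int k" "of_int k < a \<bullet> z"
  shows "(a, k) \<in> separators (sv R y) (sv R z)"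
  using assms unfolding separators_def by (auto simp: sv_simp rsign_def)

lemma rank_less:
  assumes "sbetween (sv R y) (sv R z) (sv R v)"
    and "separators (sv R y) (sv R v) = separators (sv R y) (sv R z) \<Longrightarrow> \<not> stuck y v \<and> stuck y z"
  shows "rank y v < rank y z"
proof (cases "separators (sv R y) (sv R v) = separators (sv R y) (sv R z)")
  case True
  then show ?thesis using assms(2) by (simp add: rank_def)
next
  case False
  then have "card (separators (sv R y) (sv R v)) < card (separators (sv R y) (sv R z))"
    using sbetween_separators[OF assms(1)] finite_separators by (intro psubset_card_mono) auto
  then show ?thesis unfolding rank_def by (cases "stuck y v"; cases "stuck y z") simp_all
qed

lemma not_stuck_rank:
  assumes yz: "y \<in> verts R" "z \<in> verts R" and ns: "\<not> stuck y z"
    and v: "sle (sv R v) (sv R ((1/2) *\<^sub>R (y + z)))"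
  shows "rank y v < rank y z"
proof (rule rank_less[OF midpoint_sbetween[OF v]])
  obtain a and k :: int where a: "a \<in> R" and k: "a \<bullet> y < k" "k < a \<bullet> z"
    and np: "\<not> (a \<bullet> y = k - 1/2 \<and> a \<bullet> z = of_int k + 1)"
    using ns unfolding stuck_def by auto
  obtain Y Z :: int where Y: "2 * (a \<bullet> y) = Y" and Z: "2 * (a \<bullet> z) = Z"
    using half_integral yz a by (meson Ints_cases)
  \<comment> \<open>The last hyperplane parallel to the given one before \<open>z\<close>: it separates \<open>y\<close> from \<open>z\<close> but,
    by half-integrality, not \<open>y\<close> from the midpoint.\<close>
  define l where "l = \<lceil>a \<bullet> z\<rceil> - 1"
  have l: "k \<le> l" "of_int l < a \<bullet> z" "a \<bullet> z \<le> of_int l + 1"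
    unfolding l_def using k by linarith+
  have i: "Y < 2 * k" "2 * l < Z" "Z \<le> 2 * l + 2" "\<not> (Y = 2 * k - 1 \<and> Z = 2 * k + 2)"
    using k l Y Z np by linarith+
  have "Y + Z \<le> 4 * l" using i l(1) by presburger
  then have "a \<bullet> ((1/2) *\<^sub>R (y + z)) \<le> of_int l"
    using Y Z by (simp add: inner_add_right)
  then have "\<lceil>a \<bullet> ((1/2) *\<^sub>R (y + z))\<rceil> \<le> l" by (simp add: ceiling_le_iff)
  moreover have "a \<bullet> v \<le> of_int \<lceil>a \<bullet> ((1/2) *\<^sub>R (y + z))\<rceil>"
    using closed_cell_bounds(1) v a unfolding closed_cell_def by blast
  ultimately have "a \<bullet> v \<le> of_int l" by linarith
  moreover have "a \<bullet> y < of_int l" using k l by linarith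
  ultimately have "(a, l) \<notin> separators (sv R y) (sv R v)"
    using separatorsD(2)[of a l y v] by linarith
  moreover have "(a, l) \<in> separators (sv R y) (sv R z)"
    using separatorsI[OF a \<open>a \<bullet> y < of_int l\<close> l(2)] .
  moreover assume "separators (sv R y) (sv R v) = separators (sv R y) (sv R z)"
  ultimately show "\<not> stuck y v \<and> stuck y z" by blast
qed

lemma separator_oriented:
  assumes "\<not> compat (sv R y) (sv R z)"
  obtains b and k :: int where "b \<in> R" "b \<bullet> y < k" "k < b \<bullet> z"
proof -
  obtain a k where ak: "(a, k) \<in> separators (sv R y) (sv R z)"
    using assms separators_empty_iff by fastforce
  note s = separatorsD[OF ak]
  show thesis
  proof (cases "a \<bullet> y < k \<and> k < a \<bullet> z")
    case True then show ?thesis using that s by blast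
  next
    case False
    then have "(- a) \<bullet> y < of_int (- k)" "of_int (- k) < (- a) \<bullet> z" using s by auto
    then show ?thesis using that minus_R s(1) by blast
  qed
qed

lemma stuck_pattern:
  assumes "stuck y z" "\<not> compat (sv R y) (sv R z)"
  obtains b and k :: int where "b \<in> R" "b \<bullet> y = k - 1/2" "b \<bullet> z = of_int k + 1"
    "(b, k) \<in> separators (sv R y) (sv R z)"
proof -
  obtain b and k :: int where b: "b \<in> R" "b \<bullet> y < k" "k < b \<bullet> z"
    using separator_oriented assms(2) by blast
  then show ?thesis using that[OF b(1)] assms(1) separatorsI[OF b] unfolding stuck_def by blast
qed

text \<open>
  In a stuck position with \<open>a \<bullet> z\<close> a full step above the integer \<open>a \<bullet> y\<close>, compare \<open>a\<close> with a separating
  root \<open>b\<close> with \<open>b \<bullet> y = k - 1/2\<close> and \<open>b \<bullet> z = k + 1\<close>. At the midpoint \<open>a - j = 1/2\<close> exceeds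
  \<open>b - k = 1/4\<close>, so it does at some vertex \<open>v\<close> of the cell of the midpoint. There \<open>b < k + 1\<close>, so
  either fewer hyperplanes separate \<open>y\<close> from \<open>v\<close> than from \<open>z\<close>, or \<open>y\<close> and \<open>v\<close> are not stuck.
\<close>

lemma stuck_full_step:
  assumes yz: "y \<in> verts R" "z \<in> verts R" and st: "stuck y z" "\<not> compat (sv R y) (sv R z)"
    and a: "a \<in> R" "a \<bullet> y = of_int j" "a \<bullet> z = of_int j + 1"
  shows "\<exists>v\<in>verts R. sle (sv R v) (sv R ((1/2) *\<^sub>R (y + z))) \<and> a \<bullet> v > j \<and> rank y v < rank y z"
proof -
  obtain b and k :: int where b: "b \<in> R" "b \<bullet> y = k - 1/2" "b \<bullet> z = of_int k + 1"
    "(b, k) \<in> separators (sv R y) (sv R z)"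
    using stuck_pattern[OF st] by blast
  let ?m = "(1/2) *\<^sub>R (y + z)"
  have bm: "b \<bullet> ?m = k + 1/4" and am: "a \<bullet> ?m = j + 1/2"
    using a b by (simp_all add: inner_add_right)
  have "(a - b) \<bullet> ?m > of_int j - of_int k" using am bm by (simp only: inner_diff_left)
  from vertex_above[OF this] obtain v where v: "v \<in> verts R" "sle (sv R v) (sv R ?m)"
    "(a - b) \<bullet> v > of_int j - of_int k" by blast
  have vm: "v \<in> closed_cell R ?m" using v unfolding closed_cell_def by simp
  have "\<lfloor>b \<bullet> ?m\<rfloor> = k" "\<lceil>a \<bullet> ?m\<rceil> = j + 1" unfolding bm am by linarith+
  then have bv: "k \<le> b \<bullet> v" and av: "a \<bullet> v \<le> of_int j + 1"
    using closed_cell_bounds[OF vm b(1)] closed_cell_bounds[OF vm a(1)] by simp_all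
  have "a \<bullet> v > j" "b \<bullet> v < of_int k + 1" using v(3) bv av by (simp_all add: inner_diff_left)
  moreover have "rank y v < rank y z"
  proof (rule rank_less[OF midpoint_sbetween[OF v(2)]])
    assume "separators (sv R y) (sv R v) = separators (sv R y) (sv R z)"
    then have "(b, k) \<in> separators (sv R y) (sv R v)" using b by simp
    from separatorsD(2)[OF this] have "b \<bullet> y < k" "k < b \<bullet> v" using b by linarith+
    then have "\<not> stuck y v" using b(1) \<open>b \<bullet> v < of_int k + 1\<close> unfolding stuck_def by fastforce
    then show "\<not> stuck y v \<and> stuck y z" using st by simp
  qed
  ultimately show ?thesis using v by blast
qed

text \<open>
  The key descent. If \<open>a\<close> increases from the integer \<open>j\<close> at \<open>y\<close> towards \<open>z\<close>, then it also increases
  towards some \<open>v \<in> D\<close> between \<open>y\<close> and \<open>z\<close> whose pair with \<open>y\<close> has smaller rank. In the stuck position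
  with \<open>a \<bullet> z = j + 1/2\<close>, the comparison of \<open>2 (a - j)\<close> with \<open>b - k\<close> at the midpoint yields a vertex \<open>v\<close>
  that either has smaller rank or satisfies \<open>a \<bullet> v = j + 1\<close>; in the latter case
  \<open>stuck_full_step\<close> applies to \<open>y\<close> and \<open>v\<close>.
\<close>

lemma descent_up:
  assumes D: "D \<subseteq> verts R" "midpoint_closed R D" and yz: "y \<in> D" "z \<in> D"
    and nc: "\<not> compat (sv R y) (sv R z)"
    and a: "a \<in> R" "a \<bullet> y = of_int j" "a \<bullet> z > of_int j"
  shows "\<exists>v\<in>D. sbetween (sv R y) (sv R z) (sv R v) \<and> a \<bullet> v > j \<and> rank y v < rank y z"
proof -
  let ?m = "(1/2) *\<^sub>R (y + z)"
  have yzv: "y \<in> verts R" "z \<in> verts R" using D yz by auto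
  have inD: "v \<in> D" if "v \<in> verts R" "sle (sv R v) (sv R ((1/2) *\<^sub>R (y + x)))" "x \<in> D" for v x
    using D(2) that yz unfolding midpoint_closed_def by blast
  show ?thesis
  proof (cases "stuck y z")
    case False
    have "a \<bullet> ?m > j" using a by (simp add: inner_add_right)
    from vertex_above[OF this] obtain v where v: "v \<in> verts R" "sle (sv R v) (sv R ?m)" "a \<bullet> v > j"
      by blast
    then show ?thesis using inD[OF v(1,2)] yz midpoint_sbetween not_stuck_rank[OF yzv False] by blast
  next
    case st: True
    obtain b and k :: int where b: "b \<in> R" "b \<bullet> y = k - 1/2" "b \<bullet> z = of_int k + 1"
      "(b, k) \<in> separators (sv R y) (sv R z)"
      using stuck_pattern[OF st nc] by blast
    have "\<not> (a \<bullet> y < of_int (j + 1) \<and> of_int (j + 1) < a \<bullet> z)"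
      using st a unfolding stuck_def by fastforce
    then have az: "a \<bullet> z \<le> of_int j + 1" using a by simp
    obtain Z :: int where Z: "2 * (a \<bullet> z) = Z" using half_integral yzv a by (meson Ints_cases)
    then have "Z > 2 * j" "Z \<le> 2 * j + 2" using a az by linarith+
    then have "Z = 2 * j + 1 \<or> Z = 2 * j + 2" by presburger
    then consider "a \<bullet> z = of_int j + 1" | "a \<bullet> z = of_int j + 1/2" using Z by force
    then show ?thesis
    proof cases
      case 1
      from stuck_full_step[OF yzv st nc a(1,2) this] show ?thesis
        using inD yz midpoint_sbetween by blast
    next
      case az: 2
      have bm: "b \<bullet> ?m = k + 1/4" and am: "a \<bullet> ?m = j + 1/4"
        using a b az by (simp_all add: inner_add_right)
      have "(2 *\<^sub>R a - b) \<bullet> ?m > 2 * of_int j - of_int k"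
        unfolding inner_diff_left inner_scaleR_left am bm by simp
      from vertex_above[OF this] obtain v where v: "v \<in> verts R" "sle (sv R v) (sv R ?m)"
        "(2 *\<^sub>R a - b) \<bullet> v > 2 * of_int j - of_int k" by blast
      have vm: "v \<in> closed_cell R ?m" using v unfolding closed_cell_def by simp
      have "\<lfloor>b \<bullet> ?m\<rfloor> = k" "\<lceil>a \<bullet> ?m\<rceil> = j + 1" unfolding bm am by linarith+
      then have bv: "k \<le> b \<bullet> v" and av: "a \<bullet> v \<le> of_int j + 1"
        using closed_cell_bounds[OF vm b(1)] closed_cell_bounds[OF vm a(1)] by simp_all
      have v3: "2 * (a \<bullet> v) - b \<bullet> v > 2 * j - k" using v(3) by (simp add: inner_diff_left)
      have "a \<bullet> v > j" using v3 bv by linarith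
      have vD: "v \<in> D" using inD v yz by blast
      note btw = midpoint_sbetween[OF v(2)]
      show ?thesis
      proof (cases "rank y v < rank y z")
        case True then show ?thesis using vD btw \<open>a \<bullet> v > j\<close> by blast
      next
        case False
        then have sep: "separators (sv R y) (sv R v) = separators (sv R y) (sv R z)" and stv: "stuck y v"
          using rank_less[OF btw] st by blast+
        have "(b, k) \<in> separators (sv R y) (sv R v)" using b sep by simp
        from separatorsD(2)[OF this] have "b \<bullet> y < k" "k < b \<bullet> v" using b by linarith+
        then have "b \<bullet> v = of_int k + 1" using stv b(1) unfolding stuck_def by blast
        then have "2 * (a \<bullet> v) > 2 * j + 1" using v3 by linarith
        moreover obtain V :: int where V: "2 * (a \<bullet> v) = V"
          using half_integral v(1) a(1) by (meson Ints_cases)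
        ultimately have "V = 2 * j + 2" using av by linarith
        then have "a \<bullet> v = of_int j + 1" using V by simp
        moreover have "\<not> compat (sv R y) (sv R v)" using sep nc separators_empty_iff by metis
        ultimately obtain u where u: "u \<in> verts R" "sle (sv R u) (sv R ((1/2) *\<^sub>R (y + v)))"
          "a \<bullet> u > j" "rank y u < rank y v"
          using stuck_full_step[OF yzv(1) v(1) stv _ a(1,2)] by blast
        have "rank y v = rank y z" unfolding rank_def using sep st stv by simp
        then show ?thesis
          using u inD[OF u(1,2) vD] sbetween_trans[OF btw midpoint_sbetween[OF u(2)]] by auto
      qed
    qed
  qed
qed

lemma descent:
  assumes D: "D \<subseteq> verts R" "midpoint_closed R D" and yz: "y \<in> D" "z \<in> D"
    and nc: "\<not> compat (sv R y) (sv R z)"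
    and i: "sv R y i = Zero" "sv R z i \<noteq> Zero"
  shows "\<exists>v\<in>D. sbetween (sv R y) (sv R z) (sv R v) \<and> sv R v i \<noteq> Zero \<and> rank y v < rank y z"
proof -
  obtain a j where aj: "i = (a, j)" by (cases i)
  have a: "a \<in> R" "a \<bullet> y = j" "a \<bullet> z \<noteq> j" using i aj sv_Zero_iff by blast+
  show ?thesis
  proof (cases "a \<bullet> z > j")
    case True
    from descent_up[OF D yz nc a(1,2) True] show ?thesis unfolding aj by (force simp: sv_Zero_iff a)
  next
    case False
    then have "(- a) \<bullet> y = of_int (- j)" "(- a) \<bullet> z > of_int (- j)" using a by auto
    from descent_up[OF D yz nc minus_R[OF a(1)] this] show ?thesis
      unfolding aj by (force simp: sv_Zero_iff a)
  qed
qed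

lemma sv_ne_szero: "sv R p \<noteq> szero"
proof
  assume *: "sv R p = szero"
  have "a \<bullet> p = of_int k" if "a \<in> R" for a k
    using fun_cong[OF *, of "(a, k)"] that by (simp add: szero_def sv_Zero_iff)
  then have "R = {}" by (metis ex_in_conv of_int_0 of_int_1 zero_neq_one)
  then have "(UNIV :: 'a set) = {0}" using span_R by simp
  then show False by (metis UNIV_I nonempty_Basis all_not_in_conv nonzero_Basis singletonD)
qed

lemma not_sle_szero: "\<not> sle (sv R v) szero"
  using sv_ne_szero[of v] sle_antisym[of "sv R v" szero] unfolding sle_def szero_def by auto

lemma szero_full_face: "szero \<in> full_faces R D"
  using not_sle_szero unfolding full_faces_def faces_def by blast

lemma faces_smul: "s \<in> faces R \<Longrightarrow> t \<in> faces R \<Longrightarrow> smul s t \<in> faces R"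
proof -
  have "smul (sv R p) (sv R q) \<in> range (sv R)" for p q
    using product_point[OF zero_less_one, of p q] by (metis rangeI)
  then show "s \<in> faces R \<Longrightarrow> t \<in> faces R \<Longrightarrow> smul s t \<in> faces R"
    unfolding faces_def by auto
qed

lemma face_support:
  assumes "s \<in> faces R" "s i \<noteq> Zero"
  shows "\<exists>v\<in>verts R. sle (sv R v) s \<and> sv R v i \<noteq> Zero"
proof -
  have "s \<noteq> szero" using assms(2) by (auto simp: szero_def)
  then obtain p where "s = sv R p" using assms(1) unfolding faces_def by blast
  then show ?thesis using vertex_support assms(2) by blast
qed

lemma full_faces_below:
  assumes "t \<in> full_faces R D" "s \<in> faces R" "sle s t"
  shows "s \<in> full_faces R D"
  using assms sle_trans unfolding full_faces_def by blast

lemma vertex_full_face: "v \<in> D \<Longrightarrow> D \<subseteq> verts R \<Longrightarrow> sv R v \<in> full_faces R D"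
proof -
  assume v: "v \<in> D" "D \<subseteq> verts R"
  have "u \<in> D" if "sle (sv R u) (sv R v)" for u
    using vertex_sle_eq[of v u] that v by auto
  then show ?thesis unfolding full_faces_def faces_def by auto
qed

text \<open>
  The join of two compatible faces has no vertices other than theirs. This is where the cells have
  to be simplices: a vertex \<open>v\<close> of the join is the only one off its opposite wall, so one of
  the two faces can be off that wall only if \<open>v\<close> is a vertex of it.
\<close>

lemma full_faces_join:
  assumes s: "s \<in> full_faces R D" and t: "t \<in> full_faces R D" and c: "compat s t"
  shows "smul s t \<in> full_faces R D"
proof -
  have st: "smul s t \<in> faces R" using s t faces_smul unfolding full_faces_def by blast
  have "v \<in> D" if v: "v \<in> verts R" "sle (sv R v) (smul s t)" for v
  proof -
    have "smul s t \<noteq> szero"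
    proof
      assume "smul s t = szero"
      then have "sv R v = szero" using v unfolding sle_def szero_def by fastforce
      then show False using sv_ne_szero by blast
    qed
    then obtain p where p: "smul s t = sv R p" using st unfolding faces_def by blast
    then obtain i where i: "sv R v i \<noteq> Zero"
      "\<forall>u\<in>verts R. sle (sv R u) (smul s t) \<longrightarrow> u \<noteq> v \<longrightarrow> sv R u i = Zero"
      using opposite_wall v by metis
    have "smul s t i \<noteq> Zero" using v i unfolding sle_def by metis
    then have "s i \<noteq> Zero \<or> t i \<noteq> Zero" unfolding smul_def by metis
    then obtain r where r: "r \<in> full_faces R D" "sle r (smul s t)" "r i \<noteq> Zero"
      using s t sle_smul1 sle_smul2[OF c] by metis
    then obtain u where u: "u \<in> verts R" "sle (sv R u) r" "sv R u i \<noteq> Zero"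
      using face_support unfolding full_faces_def by blast
    then have "u = v" using i(2) sle_trans r(2) by blast
    then show "v \<in> D" using u r(1) unfolding full_faces_def by blast
  qed
  then show ?thesis using st unfolding full_faces_def by blast
qed

text \<open>
  The full faces in the star of \<open>f\<close> are closed under products.
\<close>

definition star_closed :: "'a set \<Rightarrow> ('a \<times> int \<Rightarrow> sign) \<Rightarrow> bool" where
  "star_closed D f \<longleftrightarrow> (\<forall>s\<in>full_faces R D. \<forall>t\<in>full_faces R D.
     sle f s \<longrightarrow> sle f t \<longrightarrow> smul s t \<in> full_faces R D)"

lemma finite_zeros_above_vertex:
  assumes "sle (sv R y) g" "t \<in> faces R"
  shows "finite {i. g i = Zero \<and> t i \<noteq> Zero}"
proof (cases "t = szero")
  case True then show ?thesis by (simp add: szero_def)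
next
  case False
  then obtain q where q: "t = sv R q" using assms unfolding faces_def by blast
  have "{i. g i = Zero \<and> t i \<noteq> Zero} \<subseteq> {i. sv R y i = Zero \<and> sv R q i \<noteq> Zero}"
    using assms(1) q unfolding sle_def by (auto, metis)
  then show ?thesis using finite_zeros_off_support[OF finite_R] finite_subset by blast
qed

text \<open>
  Suppose that the stars of all larger faces \<open>f y\<close> are closed under products. For \<open>y, z \<in> D\<close>
  compatible with \<open>f\<close>, the descent writes \<open>f y z\<close> as a product of faces \<open>f y v\<close> with \<open>y v\<close> full by
  induction; all these factors lie in the star of \<open>f y\<close>.
\<close>

lemma vertex_products:
  assumes D: "D \<subseteq> verts R" "midpoint_closed R D" and f: "f \<in> full_faces R D"
    and IH: "\<And>y. y \<in> D \<Longrightarrow> compat f (sv R y) \<Longrightarrow> \<not> sle (sv R y) f \<Longrightarrow> star_closed D (smul f (sv R y))"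
    and yz: "y \<in> D" "z \<in> D" "compat f (sv R y)" "compat f (sv R z)"
  shows "smul (sv R y) (sv R z) \<in> full_faces R D"
  using yz
proof (induction "rank y z" arbitrary: z rule: less_induct)
  case less
  show ?case
  proof (cases "compat (sv R y) (sv R z)")
    case True
    then show ?thesis using full_faces_join vertex_full_face less.prems D(1) by blast
  next
    case nc: False
    have "\<not> sle (sv R y) f"
    proof
      assume "sle (sv R y) f"
      then have "compat (sv R y) (sv R z)" using less.prems(4) unfolding sle_def compat_def by metis
      then show False using nc by blast
    qed
    then have P: "star_closed D (smul f (sv R y))" using IH less.prems by blast
    let ?g = "smul f (sv R y)" and ?yz = "smul (sv R y) (sv R z)"
    let ?r = "smul f ?yz" and ?G = "{s \<in> full_faces R D. sle (smul f (sv R y)) s}"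
    have gL: "?g \<in> full_faces R D"
      using full_faces_join f vertex_full_face less.prems D(1) by blast
    have yzF: "?yz \<in> faces R" by (intro faces_smul) (simp_all add: faces_def)
    have "f \<in> faces R" using f by (simp add: full_faces_def)
    then have rF: "?r \<in> faces R" using yzF by (rule faces_smul)
    have cyz: "compat f ?yz"
      using compat_smul less.prems(3,4) by blast
    have "?r \<in> ?G"
    proof (rule product_cover[where g = ?g])
      show "smul s t \<in> ?G" if "s \<in> ?G" "t \<in> ?G" for s t
        using that P sle_trans sle_smul1 unfolding star_closed_def by blast
      show "?g \<in> ?G" using gL sle_refl by blast
      show "sle ?g ?r" by (metis smul_assoc sle_smul1)
      show "finite {i. ?g i = Zero \<and> ?r i \<noteq> Zero}"
        using finite_zeros_above_vertex[OF sle_smul2[OF less.prems(3)] rF] .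
      fix i assume i: "?r i \<noteq> Zero" "?g i = Zero"
      then have i': "f i = Zero" "sv R y i = Zero" "sv R z i \<noteq> Zero"
        unfolding smul_def by (auto split: if_splits)
      obtain v where v: "v \<in> D" "sbetween (sv R y) (sv R z) (sv R v)" "sv R v i \<noteq> Zero"
        "rank y v < rank y z"
        using descent[OF D less.prems(1,2) nc i'(2,3)] by blast
      have cv: "compat f (sv R v)" using sbetween_compat less.prems(3,4) v(2) by blast
      have yv: "smul (sv R y) (sv R v) \<in> full_faces R D"
        using less.hyps[OF v(4) less.prems(1) v(1) less.prems(3) cv] .
      have "compat f (smul (sv R y) (sv R v))"
        using compat_smul less.prems(3) cv by blast
      then have "smul f (smul (sv R y) (sv R v)) \<in> full_faces R D"
        using full_faces_join f yv by blast
      moreover have "sle ?g (smul f (smul (sv R y) (sv R v)))" by (metis smul_assoc sle_smul1)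
      moreover have "sle (smul f (smul (sv R y) (sv R v))) ?r"
        unfolding sle_def
      proof
        fix i
        have "sv R v i = Zero \<or> sv R v i = sv R y i \<or> sv R v i = sv R z i"
          using v(2) unfolding sbetween_def by blast
        then show "smul f (smul (sv R y) (sv R v)) i = Zero \<or> smul f (smul (sv R y) (sv R v)) i = ?r i"
          unfolding smul_def by auto
      qed
      moreover have "smul f (smul (sv R y) (sv R v)) i \<noteq> Zero" using i' v(3) unfolding smul_def by simp
      ultimately show "\<exists>x\<in>?G. sle x ?r \<and> x i \<noteq> Zero" by blast
    qed
    moreover have "sle ?yz ?r" using sle_smul2[OF cyz] .
    ultimately show ?thesis using full_faces_below yzF by blast
  qed
qed

text \<open>
  If \<open>y\<close> is a vertex of \<open>s\<close> but not of \<open>f\<close>, then \<open>s t = s (f y t)\<close>, and \<open>f y t\<close> is the product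
  of the faces \<open>f y z\<close> over the vertices \<open>z\<close> of \<open>t\<close>. All factors lie in the star of \<open>f y\<close>.
\<close>

lemma star_closed_step:
  assumes D: "D \<subseteq> verts R" "midpoint_closed R D" and f: "f \<in> full_faces R D"
    and IH: "\<And>y. y \<in> D \<Longrightarrow> compat f (sv R y) \<Longrightarrow> \<not> sle (sv R y) f \<Longrightarrow> star_closed D (smul f (sv R y))"
  shows "star_closed D f"
  unfolding star_closed_def
proof (intro ballI impI)
  fix s t assume st: "s \<in> full_faces R D" "t \<in> full_faces R D" "sle f s" "sle f t"
  show "smul s t \<in> full_faces R D"
  proof (cases "\<forall>y\<in>verts R. sle (sv R y) s \<longrightarrow> sle (sv R y) f")
    case True
    have "sle s f"
      unfolding sle_def
    proof (intro allI, rule ccontr)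
      fix i assume n: "\<not> (s i = Zero \<or> s i = f i)"
      then obtain y where y: "y \<in> verts R" "sle (sv R y) s" "sv R y i \<noteq> Zero"
        using face_support st unfolding full_faces_def by blast
      then have "sle (sv R y) f" using True by blast
      then show False using n y unfolding sle_def by metis
    qed
    then show ?thesis using st smul_absorb sle_trans by metis
  next
    case False
    then obtain y where y: "y \<in> verts R" "sle (sv R y) s" "\<not> sle (sv R y) f" by blast
    have yD: "y \<in> D" using y st unfolding full_faces_def by blast
    have cy: "compat f (sv R y)" using sle_imp_compat[OF st(3) y(2)] .
    let ?g = "smul f (sv R y)"
    let ?r = "smul ?g t" and ?G = "{s \<in> full_faces R D. sle ?g s}"
    have P: "star_closed D ?g" using IH yD cy y(3) by blast
    have gL: "?g \<in> full_faces R D"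
      using full_faces_join f vertex_full_face yD cy D(1) by blast
    have gs: "sle ?g s" using smul_least st(3) y(2) by blast
    have rF: "?r \<in> faces R" using faces_smul gL st(2) unfolding full_faces_def by blast
    have "?r \<in> ?G"
    proof (rule product_cover[where g = ?g])
      show "smul s t \<in> ?G" if "s \<in> ?G" "t \<in> ?G" for s t
        using that P sle_trans sle_smul1 unfolding star_closed_def by blast
      show "?g \<in> ?G" using gL sle_refl by blast
      show "sle ?g ?r" by (rule sle_smul1)
      show "finite {i. ?g i = Zero \<and> ?r i \<noteq> Zero}"
        using finite_zeros_above_vertex[OF sle_smul2[OF cy] rF] .
      fix i assume i: "?r i \<noteq> Zero" "?g i = Zero"
      then have "t i \<noteq> Zero" unfolding smul_def by (auto split: if_splits)
      then obtain z where z: "z \<in> verts R" "sle (sv R z) t" "sv R z i \<noteq> Zero"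
        using face_support st(2) unfolding full_faces_def by blast
      have zD: "z \<in> D" using z st unfolding full_faces_def by blast
      have cz: "compat f (sv R z)" using sle_imp_compat[OF st(4) z(2)] .
      let ?x = "smul f (smul (sv R y) (sv R z))"
      have "smul (sv R y) (sv R z) \<in> full_faces R D"
        using vertex_products[OF D f IH yD zD cy cz] .
      moreover have "compat f (smul (sv R y) (sv R z))"
        using compat_smul cy cz by blast
      ultimately have "?x \<in> full_faces R D" using full_faces_join f by blast
      moreover have "sle ?g ?x" by (metis smul_assoc sle_smul1)
      moreover have "sle ?x ?r"
        unfolding sle_def
      proof
        fix i
        have "sv R z i = Zero \<or> sv R z i = t i" using z(2) unfolding sle_def by blast
        then show "?x i = Zero \<or> ?x i = ?r i" unfolding smul_def by auto
      qed
      moreover have "?x i \<noteq> Zero" using z(3) unfolding smul_def by simp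
      ultimately show "\<exists>x\<in>?G. sle x ?r \<and> x i \<noteq> Zero" by blast
    qed
    moreover have "smul s ?r = smul s t"
    proof
      fix i
      have "?g i = Zero \<or> ?g i = s i" using gs unfolding sle_def by blast
      then show "smul s ?r i = smul s t i" unfolding smul_def by auto
    qed
    moreover have "smul s ?r \<in> full_faces R D" if "?r \<in> ?G"
      using P st(1) gs that unfolding star_closed_def by blast
    ultimately show ?thesis by metis
  qed
qed

text \<open>
  Downward induction on \<open>f\<close>: a nonempty face lies on finitely many hyperplanes, and \<open>f y\<close> lies on
  fewer of them than \<open>f\<close>.
\<close>

lemma star_closed_nonzero:
  assumes D: "D \<subseteq> verts R" "midpoint_closed R D" and f: "f \<in> full_faces R D" "f \<noteq> szero"
  shows "star_closed D f"
  using f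
proof (induction "card {(a, k). a \<in> R \<and> f (a, k) = Zero}" arbitrary: f rule: less_induct)
  case less
  obtain p where p: "f = sv R p" using less.prems unfolding full_faces_def faces_def by blast
  have fin: "finite {(a, k). a \<in> R \<and> f (a, k) = Zero}"
  proof (rule finite_subset)
    show "{(a, k). a \<in> R \<and> f (a, k) = Zero} \<subseteq> (\<lambda>a. (a, \<lfloor>a \<bullet> p\<rfloor>)) ` R"
      unfolding p by (auto simp: sv_Zero_iff image_iff)
  qed (use finite_R in auto)
  show ?case
  proof (rule star_closed_step[OF D less.prems(1)])
    fix y assume y: "y \<in> D" "compat f (sv R y)" "\<not> sle (sv R y) f"
    let ?g = "smul f (sv R y)"
    obtain i where i: "sv R y i \<noteq> Zero" "sv R y i \<noteq> f i" using y(3) unfolding sle_def by blast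
    obtain a k where ak: "i = (a, k)" by (cases i)
    have a: "a \<in> R" using i ak sv_Zero_iff by blast
    have fi: "f i = Zero" using i y(2) unfolding compat_def by metis
    have sub: "{(a, k). a \<in> R \<and> ?g (a, k) = Zero} \<subset> {(a, k). a \<in> R \<and> f (a, k) = Zero}"
    proof
      show "{(a, k). a \<in> R \<and> ?g (a, k) = Zero} \<subseteq> {(a, k). a \<in> R \<and> f (a, k) = Zero}"
        unfolding smul_def by auto
      have "(a, k) \<in> {(a, k). a \<in> R \<and> f (a, k) = Zero}" using a fi ak by simp
      moreover have "(a, k) \<notin> {(a, k). a \<in> R \<and> ?g (a, k) = Zero}"
        using i fi ak unfolding smul_def by simp
      ultimately show "{(a, k). a \<in> R \<and> ?g (a, k) = Zero} \<noteq> {(a, k). a \<in> R \<and> f (a, k) = Zero}" by blast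
    qed
    have gL: "?g \<in> full_faces R D"
      using full_faces_join less.prems(1) vertex_full_face y D(1) by blast
    have "?g i \<noteq> Zero" using i fi unfolding smul_def by simp
    then have "?g \<noteq> szero" unfolding szero_def by metis
    then show "star_closed D ?g" using less.hyps[OF psubset_card_mono[OF fin sub] gL] by blast
  qed
qed

lemma full_faces_closed:
  assumes D: "D \<subseteq> verts R" "midpoint_closed R D"
    and "s \<in> full_faces R D" "t \<in> full_faces R D"
  shows "smul s t \<in> full_faces R D"
proof -
  have "star_closed D szero"
  proof (rule star_closed_step[OF D szero_full_face])
    fix y assume "y \<in> D"
    then show "star_closed D (smul szero (sv R y))"
      using star_closed_nonzero[OF D] vertex_full_face D(1) sv_ne_szero by simp
  qed
  then show ?thesis using assms(3,4) unfolding star_closed_def sle_def szero_def by blast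
qed

end

lemma inner_self_nonpos: "x \<bullet> x \<le> 0 \<Longrightarrow> x = (0::'a::real_inner)"
  by (metis inner_eq_zero_iff inner_ge_zero antisym)


section \<open>Alcoves of irreducible root systems are simplices\<close>

text \<open>
  The axioms of a reduced, crystallographic and irreducible root system for vectors.
\<close>

locale root_arrangement = arrangement +
  assumes nonzero_R: "0 \<notin> R"
    and reflection_R: "\<lbrakk>a \<in> R; b \<in> R\<rbrakk> \<Longrightarrow> b - (2 * (b \<bullet> a) / (a \<bullet> a)) *\<^sub>R a \<in> R"
    and integral_R: "\<lbrakk>a \<in> R; b \<in> R\<rbrakk> \<Longrightarrow> 2 * (b \<bullet> a) / (a \<bullet> a) \<in> \<int>"
    and reduced_R: "\<lbrakk>a \<in> R; r *\<^sub>R a \<in> R\<rbrakk> \<Longrightarrow> r *\<^sub>R a = a \<or> r *\<^sub>R a = - a"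
    and irreducible_R: "\<lbrakk>S \<union> T = R; S \<inter> T = {}; \<And>a b. a \<in> S \<Longrightarrow> b \<in> T \<Longrightarrow> a \<bullet> b = 0\<rbrakk>
      \<Longrightarrow> S = {} \<or> T = {}"
begin

lemma diff_root:
  assumes ab: "a \<in> R" "b \<in> R" "a \<noteq> b" "a \<bullet> b > 0"
  shows "a - b \<in> R"
proof -
  have pos: "a \<bullet> a > 0" "b \<bullet> b > 0" using ab nonzero_R by auto
  obtain n m :: int where n: "2 * (a \<bullet> b) / (b \<bullet> b) = n" and m: "2 * (a \<bullet> b) / (a \<bullet> a) = m"
    using integral_R[OF ab(2,1)] integral_R[OF ab(1,2)] by (metis Ints_cases inner_commute)
  have "real_of_int n > 0" "real_of_int m > 0" using n m pos ab(4) by (metis divide_pos_pos mult_pos_pos zero_less_numeral)+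
  then have nm: "n > 0" "m > 0" by simp_all
  have n': "2 * (a \<bullet> b) = n * (b \<bullet> b)" and m': "2 * (a \<bullet> b) = m * (a \<bullet> a)"
    using n m pos by (auto simp: field_simps)
  consider "n = 1" | "m = 1" | "n \<ge> 2" "m \<ge> 2" using nm by linarith
  then show ?thesis
  proof cases
    case 1
    then show ?thesis using reflection_R[OF ab(2,1)] n by simp
  next
    case 2
    then have "b - a \<in> R" using reflection_R[OF ab(1,2)] m by (simp add: inner_commute)
    then show ?thesis using minus_R by fastforce
  next
    case 3
    \<comment> \<open>Both Cartan integers are at least 2, which forces \<open>a = b\<close>.\<close>
    have "2 * (a \<bullet> b) \<ge> 2 * (b \<bullet> b)" unfolding n' using 3 pos by (intro mult_right_mono) auto
    moreover have "2 * (a \<bullet> b) \<ge> 2 * (a \<bullet> a)" unfolding m' using 3 pos by (intro mult_right_mono) auto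
    ultimately have "(a - b) \<bullet> (a - b) \<le> 0"
      by (simp add: inner_diff_left inner_diff_right inner_commute)
    then show ?thesis using ab(3) inner_self_nonpos by force
  qed
qed

lemma generic_direction:
  assumes "finite S" "0 \<notin> S"
  shows "\<exists>w::'a. \<forall>a\<in>S. a \<bullet> w \<noteq> 0"
  using assms
proof (induction S)
  case (insert b S)
  then obtain w where w: "\<forall>a\<in>S. a \<bullet> w \<noteq> 0" by auto
  have "finite (insert (- (b \<bullet> w) / (b \<bullet> b)) ((\<lambda>a. - (a \<bullet> w) / (a \<bullet> b)) ` S))" using insert by simp
  then obtain e :: real where e: "e \<notin> insert (- (b \<bullet> w) / (b \<bullet> b)) (insert 0 ((\<lambda>a. - (a \<bullet> w) / (a \<bullet> b)) ` S))"
    using ex_new_if_finite[OF infinite_UNIV_char_0, of "insert (- (b \<bullet> w) / (b \<bullet> b)) (insert 0 ((\<lambda>a. - (a \<bullet> w) / (a \<bullet> b)) ` S))"]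
    by auto
  have "a \<bullet> (w + e *\<^sub>R b) \<noteq> 0" if a: "a \<in> insert b S" for a
  proof
    assume z: "a \<bullet> (w + e *\<^sub>R b) = 0"
    then have z': "a \<bullet> w + e * (a \<bullet> b) = 0" by (simp add: inner_add_right)
    show False
    proof (cases "a \<bullet> b = 0")
      case True
      then show False using z' w a insert.prems by auto
    next
      case False
      then have "e = - (a \<bullet> w) / (a \<bullet> b)" using z' by (simp add: field_simps)
      then show False using e a by auto
    qed
  qed
  then show ?case by blast
qed simp

text \<open>
  Every cell is a face of an alcove.
\<close>

lemma generic_coface:
  "\<exists>c. sle (sv R p) (sv R c) \<and> (\<forall>a\<in>R. a \<bullet> c \<notin> \<int>)"
proof -
  obtain w where w: "\<forall>a\<in>R. a \<bullet> w \<noteq> 0" using generic_direction[OF finite_R nonzero_R] by blast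
  obtain e where e: "\<forall>a\<in>R. \<forall>k::int. rsign (a \<bullet> (p + e *\<^sub>R w) - k) =
      (if a \<bullet> p = k then rsign (a \<bullet> w) else rsign (a \<bullet> p - k))"
    using sv_ray_ex[OF zero_less_one, of p w] by blast
  have "sle (sv R p) (sv R (p + e *\<^sub>R w))" unfolding sle_sv_iff using e by auto
  moreover have "a \<bullet> (p + e *\<^sub>R w) \<notin> \<int>" if a: "a \<in> R" for a
  proof
    assume "a \<bullet> (p + e *\<^sub>R w) \<in> \<int>"
    then obtain k :: int where k: "a \<bullet> (p + e *\<^sub>R w) = k" by (auto elim: Ints_cases)
    then have "rsign (a \<bullet> (p + e *\<^sub>R w) - k) = Zero" by simp
    then have "(if a \<bullet> p = k then rsign (a \<bullet> w) else rsign (a \<bullet> p - k)) = Zero" using e a by metis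
    then show False using w a by (auto split: if_splits)
  qed
  ultimately show ?thesis by blast
qed

end

text \<open>
  An alcove, given by a point \<open>c\<close> in it, with a set \<open>B\<close> of roots that is minimal among the sets of
  roots whose inequalities cut out the closed alcove. The elements of \<open>B\<close> are the outer normals of
  the facets.
\<close>

locale alcove = root_arrangement R for R :: "'a::euclidean_space set" +
  fixes c :: 'a and B :: "'a set"
  assumes generic: "a \<in> R \<Longrightarrow> a \<bullet> c \<notin> \<int>"
    and B_R: "B \<subseteq> R"
    and B_halfspaces: "{x. \<forall>a\<in>B. a \<bullet> x \<le> of_int \<lceil>a \<bullet> c\<rceil>} = closed_cell R c"
    and B_minimal: "b \<in> B \<Longrightarrow> {x. \<forall>a\<in>B - {b}. a \<bullet> x \<le> of_int \<lceil>a \<bullet> c\<rceil>} \<noteq> closed_cell R c"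
begin

text \<open>
  The upper bound of the root \<open>a\<close> on the closed alcove.
\<close>

abbreviation bd :: "'a \<Rightarrow> int" where
  "bd a \<equiv> \<lceil>a \<bullet> c\<rceil>"

lemma bd_strict: "a \<in> R \<Longrightarrow> a \<bullet> c < of_int (bd a)"
  using generic[of a] by (metis Ints_of_int le_of_int_ceiling order_le_less)

lemma bd_minus: "a \<in> R \<Longrightarrow> bd (- a) = 1 - bd a"
proof -
  assume a: "a \<in> R"
  have "\<lfloor>a \<bullet> c\<rfloor> = \<lceil>a \<bullet> c\<rceil> - 1" using bd_strict[OF a] by linarith
  then show ?thesis by (simp add: ceiling_minus)
qed

lemma in_closed_alcove: "x \<in> closed_cell R c \<longleftrightarrow> (\<forall>a\<in>B. a \<bullet> x \<le> of_int (bd a))"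
  using B_halfspaces by auto

lemma finite_B: "finite B"
  using B_R finite_R finite_subset by blast

text \<open>
  Each facet contains a point that lies on no other facet.
\<close>

lemma facet_point:
  assumes b: "b \<in> B"
  shows "\<exists>f. b \<bullet> f = of_int (bd b) \<and> (\<forall>a\<in>B - {b}. a \<bullet> f < of_int (bd a))"
proof -
  have "closed_cell R c \<subseteq> {x. \<forall>a\<in>B - {b}. a \<bullet> x \<le> of_int (bd a)}" using in_closed_alcove by auto
  then obtain x where x: "\<forall>a\<in>B - {b}. a \<bullet> x \<le> of_int (bd a)" "x \<notin> closed_cell R c"
    using B_minimal[OF b] by blast
  then have bx: "b \<bullet> x > of_int (bd b)" using in_closed_alcove by force
  have bc: "b \<bullet> c < of_int (bd b)" using bd_strict b B_R by blast
  define t where "t = (of_int (bd b) - b \<bullet> c) / (b \<bullet> x - b \<bullet> c)"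
  have t: "0 < t" "t < 1" unfolding t_def using bx bc by (auto simp: field_simps)
  let ?f = "c + t *\<^sub>R (x - c)"
  have f: "a \<bullet> ?f = (1 - t) * (a \<bullet> c) + t * (a \<bullet> x)" for a
    by (simp add: inner_add_right inner_diff_right algebra_simps)
  have "t * (b \<bullet> x - b \<bullet> c) = of_int (bd b) - b \<bullet> c" unfolding t_def using bx bc by simp
  then have "b \<bullet> ?f = of_int (bd b)" by (simp add: inner_add_right inner_diff_right)
  moreover have "a \<bullet> ?f < of_int (bd a)" if a: "a \<in> B - {b}" for a
  proof -
    have "(1 - t) * (a \<bullet> c) < (1 - t) * of_int (bd a)"
      using t bd_strict[of a] a B_R by (intro mult_strict_left_mono) auto
    moreover have "t * (a \<bullet> x) \<le> t * of_int (bd a)" using t x a by (intro mult_left_mono) auto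
    ultimately show ?thesis unfolding f by (simp add: algebra_simps)
  qed
  ultimately show ?thesis by blast
qed

lemma facet_point_alcove:
  assumes "b \<in> B" "b \<bullet> f = of_int (bd b)" "\<forall>a\<in>B - {b}. a \<bullet> f < of_int (bd a)" "a \<in> R"
  shows "a \<bullet> f \<le> of_int (bd a)"
proof -
  have "f \<in> closed_cell R c" unfolding in_closed_alcove using assms by force
  then show ?thesis using closed_cell_bounds(1) assms by blast
qed

text \<open>
  If \<open>a - b\<close> were a root, the hyperplane on which it equals \<open>bd a - bd b\<close> would strictly separate a
  point in the interior of the facet of \<open>a\<close> from one in the interior of the facet of \<open>b\<close>, but no
  hyperplane of the arrangement cuts the alcove.
\<close>

lemma base_diff_not_root:
  assumes ab: "a \<in> B" "b \<in> B" "a \<noteq> b"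
  shows "a - b \<notin> R"
proof
  assume d: "a - b \<in> R"
  obtain f where f: "a \<bullet> f = of_int (bd a)" "\<forall>x\<in>B - {a}. x \<bullet> f < of_int (bd x)"
    using facet_point ab by blast
  obtain g where g: "b \<bullet> g = of_int (bd b)" "\<forall>x\<in>B - {b}. x \<bullet> g < of_int (bd x)"
    using facet_point ab by blast
  have "b \<bullet> f < of_int (bd b)" "a \<bullet> g < of_int (bd a)" using f g ab by auto
  moreover have "(a - b) \<bullet> f \<le> of_int (bd (a - b))" using facet_point_alcove[OF ab(1) f d] .
  moreover have "(- (a - b)) \<bullet> g \<le> of_int (bd (- (a - b)))"
    using facet_point_alcove[OF ab(2) g minus_R[OF d]] .
  ultimately have "of_int (bd a) - of_int (bd b) < real_of_int (bd (a - b))"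
     "of_int (bd b) - of_int (bd a) < real_of_int (bd (- (a - b)))"
    using f(1) g(1) by (simp_all only: inner_diff_left inner_minus_left)
  then have "bd a - bd b + 1 \<le> bd (a - b)" "bd b - bd a + 1 \<le> bd (- (a - b))" by linarith+
  then show False using bd_minus[OF d] by linarith
qed

lemma base_obtuse:
  assumes "a \<in> B" "b \<in> B" "a \<noteq> b"
  shows "a \<bullet> b \<le> 0"
  using base_diff_not_root[OF assms] diff_root[of a b] assms B_R by force

text \<open>
  A root that attains its bound at a point in the interior of a facet is the normal of that facet.
\<close>

lemma tight_root:
  assumes b: "b \<in> B" and f: "b \<bullet> f = of_int (bd b)" "\<forall>a\<in>B - {b}. a \<bullet> f < of_int (bd a)"
    and g: "g \<in> R" "g \<bullet> f = of_int (bd g)"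
  shows "g = b"
proof -
  have bR: "b \<in> R" using b B_R by blast
  have bb: "b \<bullet> b \<noteq> 0" using nonzero_R bR by auto
  define w where "w = g - (g \<bullet> b / (b \<bullet> b)) *\<^sub>R b"
  have bw: "b \<bullet> w = 0" unfolding w_def using bb by (simp add: inner_diff_right inner_commute)
  have gw: "g \<bullet> w = w \<bullet> w"
  proof -
    have "w \<bullet> w = g \<bullet> w - (g \<bullet> b / (b \<bullet> b)) * (b \<bullet> w)" unfolding w_def by (simp add: inner_diff_left)
    then show ?thesis using bw by simp
  qed
  have "\<forall>a\<in>B - {b}. eventually (\<lambda>e. a \<bullet> (f + e *\<^sub>R w) < of_int (bd a)) (at_right 0)"
  proof
    fix a assume a: "a \<in> B - {b}"
    have "((\<lambda>e. a \<bullet> (f + e *\<^sub>R w)) \<longlongrightarrow> a \<bullet> (f + 0 *\<^sub>R w)) (at_right 0)" by (intro tendsto_intros)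
    then show "eventually (\<lambda>e. a \<bullet> (f + e *\<^sub>R w) < of_int (bd a)) (at_right 0)"
      using f a by (intro order_tendstoD(2)) auto
  qed
  then have "eventually (\<lambda>e. \<forall>a\<in>B - {b}. a \<bullet> (f + e *\<^sub>R w) < of_int (bd a)) (at_right 0)"
    by (simp add: eventually_ball_finite_distrib finite_B)
  then obtain d where d: "d > 0" "\<forall>e>0. e < d \<longrightarrow> (\<forall>a\<in>B - {b}. a \<bullet> (f + e *\<^sub>R w) < of_int (bd a))"
    unfolding eventually_at_right_field by auto
  then have e: "\<forall>a\<in>B - {b}. a \<bullet> (f + (d/2) *\<^sub>R w) < of_int (bd a)" by simp
  have "b \<bullet> (f + (d/2) *\<^sub>R w) = of_int (bd b)" using f bw by (simp add: inner_add_right)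
  from facet_point_alcove[OF b this e g(1)] have "(d/2) * (w \<bullet> w) \<le> 0"
    using g gw by (simp add: inner_add_right)
  then have "w \<bullet> w \<le> 0" using d(1) by (simp add: mult_le_0_iff)
  then have "w = 0" by (rule inner_self_nonpos)
  then have geq: "g = (g \<bullet> b / (b \<bullet> b)) *\<^sub>R b" unfolding w_def by simp
  then have "g = b \<or> g = - b" using reduced_R[OF bR, of "g \<bullet> b / (b \<bullet> b)"] g(1) by metis
  moreover have "g \<noteq> - b"
  proof
    assume "g = - b"
    then have "- of_int (bd b) = real_of_int (1 - bd b)" using g f bd_minus[OF bR] by simp
    then show False by simp
  qed
  ultimately show ?thesis by blast
qed

text \<open>
  The closed alcove contains no ray.
\<close>

lemma orthogonal_base_zero:
  assumes "\<And>b. b \<in> B \<Longrightarrow> b \<bullet> w \<le> 0"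
  shows "w = 0"
proof (rule no_recession_direction)
  fix t :: real assume t: "t \<ge> 0"
  show "c + t *\<^sub>R w \<in> closed_cell R c"
    unfolding in_closed_alcove
  proof
    fix a assume a: "a \<in> B"
    have "a \<bullet> c < of_int (bd a)" using bd_strict a B_R by blast
    moreover have "t * (a \<bullet> w) \<le> 0" using t assms[OF a] by (simp add: mult_nonneg_nonpos)
    ultimately show "a \<bullet> (c + t *\<^sub>R w) \<le> of_int (bd a)" by (simp add: inner_add_right)
  qed
qed

lemma span_B: "span B = UNIV"
proof (rule ccontr)
  assume "span B \<noteq> UNIV"
  then obtain w where "w \<noteq> 0" "\<forall>x\<in>span B. w \<bullet> x = 0" using span_not_UNIV_orthogonal by blast
  then have "w = 0" by (intro orthogonal_base_zero) (simp add: inner_commute span_base)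
  then show False using \<open>w \<noteq> 0\<close> by simp
qed

lemma orthogonal_decomposition:
  assumes "B1 \<union> B2 = B" "\<And>a b. a \<in> B1 \<Longrightarrow> b \<in> B2 \<Longrightarrow> a \<bullet> b = 0"
  obtains u v where "g = u + v" "u \<in> span B1" "v \<in> span B2"
     "\<And>b. b \<in> B1 \<Longrightarrow> b \<bullet> v = 0" "\<And>b. b \<in> B2 \<Longrightarrow> b \<bullet> u = 0"
proof -
  have "g \<in> span (B1 \<union> B2)" using span_B assms(1) by simp
  then obtain u v where uv: "g = u + v" "u \<in> span B1" "v \<in> span B2" unfolding span_Un by auto
  have "b \<bullet> v = 0" if "b \<in> B1" for b
    using uv(3)
  proof (induction rule: span_induct_alt)
    case (step r x y) then show ?case using assms(2) that by (simp add: inner_add_right)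
  qed simp
  moreover have "b \<bullet> u = 0" if "b \<in> B2" for b
    using uv(2)
  proof (induction rule: span_induct_alt)
    case (step r x y) then show ?case using assms(2)[of x b] that by (simp add: inner_add_right inner_commute)
  qed simp
  ultimately show thesis using that uv by blast
qed

text \<open>
  Irreducibility passes from the root system to the facet normals. Suppose that \<open>B\<close> is the union of
  two orthogonal parts \<open>B1\<close>, \<open>B2\<close>, and call a root mixed if it is orthogonal to neither. Among the
  mixed roots let \<open>m\<close> be one whose hyperplane \<open>m \<bullet> x = bd m\<close> is nearest to \<open>c\<close>, measured by \<open>m\<close>.
  For suitable \<open>b1 \<in> B1\<close> and \<open>b2 \<in> B2\<close>, the roots \<open>m - b1\<close> and \<open>m - b2\<close> have nearer hyperplanes, so
  they are not mixed, which forces \<open>m = b1 + b2\<close>. But then the reflection of \<open>m\<close> in \<open>b1\<close> is the root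
  \<open>b2 - b1\<close>, contradicting \<open>base_diff_not_root\<close>. Without mixed roots, the root system splits.
\<close>

lemma base_irreducible:
  assumes B12: "B1 \<union> B2 = B" "B1 \<inter> B2 = {}" "\<And>a b. a \<in> B1 \<Longrightarrow> b \<in> B2 \<Longrightarrow> a \<bullet> b = 0"
  shows "B1 = {} \<or> B2 = {}"
proof -
  let ?mixed = "\<lambda>g. (\<exists>b\<in>B1. g \<bullet> b \<noteq> 0) \<and> (\<exists>b\<in>B2. g \<bullet> b \<noteq> 0)"
  have no_mixed: "\<not> ?mixed g" if "g \<in> R" for g
  proof
    assume "?mixed g"
    let ?M = "{g \<in> R. ?mixed g}"
    let ?h = "\<lambda>g. of_int (bd g) - g \<bullet> c"
    have "finite ?M" "?M \<noteq> {}" using finite_R that \<open>?mixed g\<close> by auto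
    note arg = arg_min_if_finite[OF this, of ?h]
    define m where "m = arg_min_on ?h ?M"
    have m: "m \<in> R" "?mixed m" using arg(1) unfolding m_def by blast+
    have min: "?h m \<le> ?h g" if "g \<in> R" "?mixed g" for g
      using arg(2) that unfolding m_def[symmetric] by (metis (mono_tags, lifting) mem_Collect_eq not_less)
    obtain u v where uv: "m = u + v" "u \<in> span B1" "v \<in> span B2"
      "\<And>b. b \<in> B1 \<Longrightarrow> b \<bullet> v = 0" "\<And>b. b \<in> B2 \<Longrightarrow> b \<bullet> u = 0"
      using orthogonal_decomposition[OF B12(1,3)] by metis
    have mu: "m \<bullet> b = b \<bullet> u" if "b \<in> B1" for b using uv that by (simp add: inner_add_left inner_add_right inner_commute)
    have mv: "m \<bullet> b = b \<bullet> v" if "b \<in> B2" for b using uv that by (simp add: inner_add_left inner_add_right inner_commute)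
    obtain b1 where b1: "b1 \<in> B1" "m \<bullet> b1 > 0"
    proof (rule ccontr)
      assume "\<not> thesis"
      then have "\<And>b. b \<in> B \<Longrightarrow> b \<bullet> u \<le> 0" using that mu uv(5) B12(1) by (metis Un_iff linorder_not_le order_refl)
      then have "u = 0" by (rule orthogonal_base_zero)
      then show False using m mu by auto
    qed
    obtain b2 where b2: "b2 \<in> B2" "m \<bullet> b2 > 0"
    proof (rule ccontr)
      assume "\<not> thesis"
      then have "\<And>b. b \<in> B \<Longrightarrow> b \<bullet> v \<le> 0" using that mv uv(4) B12(1) by (metis Un_iff linorder_not_le order_refl)
      then have "v = 0" by (rule orthogonal_base_zero)
      then show False using m mv by auto
    qed
    have bB: "b1 \<in> B" "b2 \<in> B" "b1 \<in> R" "b2 \<in> R" using b1 b2 B12 B_R by auto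
    have lower: "m - b \<in> R \<and> \<not> ?mixed (m - b)" if b: "b \<in> B" "m \<bullet> b > 0" "m \<noteq> b" for b
    proof -
      have bR: "b \<in> R" using b B_R by auto
      have d: "m - b \<in> R" using diff_root[OF m(1) bR b(3,2)] .
      have "bd m = bd (m - b) + bd b"
      proof (rule ccontr)
        assume ne: "bd m \<noteq> bd (m - b) + bd b"
        have mm: "m \<bullet> c = (m - b) \<bullet> c + b \<bullet> c" by (simp add: inner_diff_left)
        have eq: "bd m = bd (m - b) + bd b - 1"
          using ne mm bd_strict[OF d] bd_strict[OF bR] bd_strict[OF m(1)] by linarith
        obtain f where f: "b \<bullet> f = of_int (bd b)" "\<forall>x\<in>B - {b}. x \<bullet> f < of_int (bd x)"
          using facet_point b by blast
        have "m \<bullet> f \<le> of_int (bd m)" using facet_point_alcove[OF b(1) f m(1)] .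
        moreover have "(- (m - b)) \<bullet> f \<le> of_int (bd (- (m - b)))"
          using facet_point_alcove[OF b(1) f minus_R[OF d]] .
        ultimately have "m \<bullet> f = of_int (bd m)"
          using f(1) eq unfolding bd_minus[OF d] by (simp add: inner_diff_left)
        then show False using tight_root[OF b(1) f m(1)] b(3) by blast
      qed
      then have "?h (m - b) < ?h m" using bd_strict[OF bR] by (simp add: inner_diff_left)
      then show ?thesis using min[OF d] d by fastforce
    qed
    have ne: "m \<noteq> b1" "m \<noteq> b2"
      using m B12(3) b1(1) b2(1) by (metis inner_commute)+
    have o1: "(m - b1) \<bullet> b = 0" if "b \<in> B1" for b
    proof (rule ccontr)
      assume "(m - b1) \<bullet> b \<noteq> 0"
      moreover have "(m - b1) \<bullet> b2 \<noteq> 0" using b2 B12(3) b1 by (simp add: inner_diff_left)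
      ultimately show False using lower[OF bB(1) b1(2) ne(1)] that b2 by blast
    qed
    have o2: "(m - b2) \<bullet> b = 0" if "b \<in> B2" for b
    proof (rule ccontr)
      assume "(m - b2) \<bullet> b \<noteq> 0"
      moreover have "(m - b2) \<bullet> b1 \<noteq> 0" using b1 B12(3)[OF b1(1) b2(1)] inner_commute[of b2 b1] by (simp add: inner_diff_left)
      ultimately show False using lower[OF bB(2) b2(2) ne(2)] that b1 by blast
    qed
    have "m - b1 - b2 = 0"
    proof (rule orthogonal_base_zero)
      fix b assume "b \<in> B"
      then consider "b \<in> B1" | "b \<in> B2" using B12 by blast
      then have "(m - b1 - b2) \<bullet> b = 0"
      proof cases
        case 1
        have "(m - b1 - b2) \<bullet> b = (m - b1) \<bullet> b - b \<bullet> b2"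
          by (simp add: inner_diff_left inner_commute[of b b2])
        then show ?thesis using o1[OF 1] B12(3)[OF 1 b2(1)] by simp
      next
        case 2
        have "(m - b1 - b2) \<bullet> b = (m - b2) \<bullet> b - b1 \<bullet> b"
          by (simp add: inner_diff_left)
        then show ?thesis using o2[OF 2] B12(3)[OF b1(1) 2] by simp
      qed
      then show "b \<bullet> (m - b1 - b2) \<le> 0" by (simp add: inner_commute)
    qed
    then have meq: "m = b1 + b2" by (simp add: algebra_simps)
    have b1b1: "b1 \<bullet> b1 \<noteq> 0" using nonzero_R bB by auto
    have "m \<bullet> b1 = b1 \<bullet> b1" using B12(3)[OF b1(1) b2(1)] meq by (simp add: inner_add_left inner_commute[of b2 b1])
    then have "m - 2 *\<^sub>R b1 \<in> R" using reflection_R[OF bB(3) m(1)] b1b1 by simp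
    then have "b2 - b1 \<in> R" using meq by (simp add: scaleR_2 algebra_simps)
    moreover have "b1 \<noteq> b2" using B12(2) b1 b2 by blast
    ultimately show False using base_diff_not_root bB by blast
  qed
  let ?R1 = "{g \<in> R. \<exists>b\<in>B1. g \<bullet> b \<noteq> 0}" and ?R2 = "{g \<in> R. \<forall>b\<in>B1. g \<bullet> b = 0}"
  have "?R1 = {} \<or> ?R2 = {}"
  proof (rule irreducible_R)
    show "?R1 \<union> ?R2 = R" "?R1 \<inter> ?R2 = {}" by auto
    fix g h assume gh: "g \<in> ?R1" "h \<in> ?R2"
    then have g2: "\<And>b. b \<in> B2 \<Longrightarrow> g \<bullet> b = 0" using no_mixed by blast
    obtain u v where uv: "g = u + v" "u \<in> span B1" "v \<in> span B2"
      "\<And>b. b \<in> B1 \<Longrightarrow> b \<bullet> v = 0" "\<And>b. b \<in> B2 \<Longrightarrow> b \<bullet> u = 0"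
      using orthogonal_decomposition[OF B12(1,3)] by metis
    have "v = 0"
    proof (rule orthogonal_base_zero)
      fix b assume "b \<in> B"
      then consider "b \<in> B1" | "b \<in> B2" using B12 by blast
      then show "b \<bullet> v \<le> 0"
      proof cases
        case 2
        then show ?thesis using g2[OF 2] uv(5)[OF 2] uv(1) by (simp add: inner_add_right inner_commute[of _ b])
      qed (simp add: uv)
    qed
    then have "g \<in> span B1" using uv by simp
    then show "g \<bullet> h = 0"
    proof (induction rule: span_induct_alt)
      case (step r x y) then have "h \<bullet> x = 0" using gh step(1) by blast
      then show ?case using step by (simp add: inner_add_left inner_commute[of x h])
    qed simp
  qed
  then show ?thesis
  proof
    assume e: "?R1 = {}"
    have "B1 = {}"
    proof (rule ccontr)
      assume "B1 \<noteq> {}"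
      then obtain b where b: "b \<in> B1" "b \<in> R" using B12 B_R by blast
      then have "b \<bullet> b = 0" using e by blast
      then show False using b nonzero_R by auto
    qed
    then show ?thesis ..
  next
    assume e: "?R2 = {}"
    have "B2 = {}"
    proof (rule ccontr)
      assume "B2 \<noteq> {}"
      then obtain b where b: "b \<in> B2" "b \<in> R" using B12 B_R by blast
      then have "b \<in> ?R2" using B12(3) by (auto simp: inner_commute)
      then show False using e by blast
    qed
    then show ?thesis ..
  qed
qed

text \<open>
  The standard argument for vectors with pairwise nonpositive inner products: in a linear dependency,
  the terms with positive coefficients sum to zero by themselves and are orthogonal to the other
  vectors.
\<close>

lemma dependency_full_support:
  fixes r :: "'a \<Rightarrow> real"
  assumes dep: "(\<Sum>b\<in>B. r b *\<^sub>R b) = 0" and b0: "b0 \<in> B" "r b0 \<noteq> 0" and b: "b \<in> B"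
  shows "r b \<noteq> 0"
proof -
  have main: "\<forall>b\<in>B. s b > 0" if dep: "(\<Sum>b\<in>B. s b *\<^sub>R b) = 0" and b0: "s b0 > 0" for s :: "'a \<Rightarrow> real"
  proof -
    let ?I = "{b \<in> B. s b > 0}" and ?J = "{b \<in> B. \<not> s b > 0}"
    define u where "u = (\<Sum>b\<in>?I. s b *\<^sub>R b)"
    have "(\<Sum>b\<in>B. s b *\<^sub>R b) = u + (\<Sum>b\<in>?J. s b *\<^sub>R b)"
      unfolding u_def using finite_B by (subst sum.union_disjoint[symmetric]) (auto intro!: sum.cong)
    then have u': "u = - (\<Sum>b\<in>?J. s b *\<^sub>R b)" using dep by (simp add: eq_neg_iff_add_eq_0)
    have "u \<bullet> u = - (\<Sum>a\<in>?I. \<Sum>b\<in>?J. s a * s b * (a \<bullet> b))"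
      by (subst (2) u') (simp add: u_def inner_sum_left inner_sum_right sum_distrib_left mult.assoc,
        subst sum.swap, simp add: mult.left_commute)
    also have "\<dots> \<le> 0"
    proof -
      have "0 \<le> s a * s b * (a \<bullet> b)" if "a \<in> ?I" "b \<in> ?J" for a b
      proof -
        have "a \<bullet> b \<le> 0" using that by (intro base_obtuse) auto
        moreover have "s a * s b \<le> 0" using that by (auto simp: mult_nonneg_nonpos)
        ultimately show ?thesis by (rule mult_nonpos_nonpos[rotated])
      qed
      then have "0 \<le> (\<Sum>a\<in>?I. \<Sum>b\<in>?J. s a * s b * (a \<bullet> b))" by (intro sum_nonneg) blast
      then show ?thesis by linarith
    qed
    finally have u0: "u = 0" by (rule inner_self_nonpos)
    have orth: "a \<bullet> b = 0" if ab: "a \<in> ?I" "b \<in> ?J" for a b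
    proof -
      have "(\<Sum>a\<in>?I. s a * (a \<bullet> b)) = u \<bullet> b" unfolding u_def by (simp add: inner_sum_left)
      then have "(\<Sum>a\<in>?I. - (s a * (a \<bullet> b))) = 0" using u0 by (simp add: sum_negf)
      moreover have "0 \<le> - (s a * (a \<bullet> b))" if a: "a \<in> ?I" for a
      proof -
        have "a \<bullet> b \<le> 0" using a ab by (intro base_obtuse) auto
        then show ?thesis using a by (simp add: mult_nonneg_nonpos)
      qed
      ultimately have "- (s a * (a \<bullet> b)) = 0"
        using sum_nonneg_eq_0_iff[of ?I "\<lambda>a. - (s a * (a \<bullet> b))"] finite_B ab(1) by auto
      then show ?thesis using ab by auto
    qed
    have "?I = {} \<or> ?J = {}" by (rule base_irreducible) (use orth in auto)
    then show ?thesis using b0 \<open>b0 \<in> B\<close> by blast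
  qed
  show ?thesis
  proof (cases "r b0 > 0")
    case True then show ?thesis using main[of r] dep b by fastforce
  next
    case False
    have "(\<Sum>b\<in>B. (- r b) *\<^sub>R b) = 0" using dep by (simp add: sum_negf)
    then show ?thesis using main[of "\<lambda>b. - r b"] False b0 b by fastforce
  qed
qed

lemma independent_facets: "b \<in> B \<Longrightarrow> independent (B - {b})"
proof
  assume b: "b \<in> B" and "dependent (B - {b})"
  then obtain r a where r: "a \<in> B - {b}" "r a \<noteq> 0" "(\<Sum>v\<in>B - {b}. r v *\<^sub>R v) = 0"
    using dependent_finite[of "B - {b}"] finite_B by auto
  let ?r = "\<lambda>v. if v = b then 0 else r v"
  have "(\<Sum>v\<in>B. ?r v *\<^sub>R v) = (\<Sum>v\<in>B - {b}. r v *\<^sub>R v)"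
    using finite_B b by (simp add: sum.remove[of B b])
  then have "?r b \<noteq> 0" using r dependency_full_support[of ?r a b] b by auto
  then show False by simp
qed

text \<open>
  The facets through a vertex of the closed alcove determine it.
\<close>

lemma active_rigid:
  assumes v: "v \<in> verts R" "v \<in> closed_cell R c"
    and w: "\<And>b. b \<in> B \<Longrightarrow> b \<bullet> v = of_int (bd b) \<Longrightarrow> b \<bullet> w = 0"
  shows "w = 0"
proof (rule vertex_rigid[OF v(1)])
  have ev: "\<forall>b\<in>B. eventually (\<lambda>e. b \<bullet> (v + e *\<^sub>R w) \<le> of_int (bd b) \<and> b \<bullet> (v - e *\<^sub>R w) \<le> of_int (bd b)) (at_right 0)"
  proof
    fix b assume b: "b \<in> B"
    show "eventually (\<lambda>e. b \<bullet> (v + e *\<^sub>R w) \<le> of_int (bd b) \<and> b \<bullet> (v - e *\<^sub>R w) \<le> of_int (bd b)) (at_right 0)"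
    proof (cases "b \<bullet> v = of_int (bd b)")
      case True
      then show ?thesis using w[OF b] by (simp add: inner_add_right inner_diff_right)
    next
      case False
      then have lt: "b \<bullet> v < of_int (bd b)" using v(2) b in_closed_alcove by force
      have 1: "((\<lambda>e. b \<bullet> (v + e *\<^sub>R w)) \<longlongrightarrow> b \<bullet> (v + 0 *\<^sub>R w)) (at_right 0)" by (intro tendsto_intros)
      have 2: "((\<lambda>e. b \<bullet> (v - e *\<^sub>R w)) \<longlongrightarrow> b \<bullet> (v - 0 *\<^sub>R w)) (at_right 0)" by (intro tendsto_intros)
      have "eventually (\<lambda>e. b \<bullet> (v + e *\<^sub>R w) < of_int (bd b)) (at_right 0)"
        "eventually (\<lambda>e. b \<bullet> (v - e *\<^sub>R w) < of_int (bd b)) (at_right 0)"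
        using order_tendstoD(2)[OF 1] order_tendstoD(2)[OF 2] lt by auto
      then show ?thesis by eventually_elim auto
    qed
  qed
  have ev': "eventually (\<lambda>e. \<forall>b\<in>B. b \<bullet> (v + e *\<^sub>R w) \<le> of_int (bd b) \<and> b \<bullet> (v - e *\<^sub>R w) \<le> of_int (bd b)) (at_right 0)"
    using ev by (simp only: eventually_ball_finite_distrib finite_B)
  obtain d where d: "d > 0" "\<forall>e>0. e < d \<longrightarrow> (\<forall>b\<in>B. b \<bullet> (v + e *\<^sub>R w) \<le> of_int (bd b) \<and> b \<bullet> (v - e *\<^sub>R w) \<le> of_int (bd b))"
    using ev' unfolding eventually_at_right_field by auto
  let ?e = "d / 2"
  have in1: "v + ?e *\<^sub>R w \<in> closed_cell R c" and in2: "v - ?e *\<^sub>R w \<in> closed_cell R c"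
    unfolding in_closed_alcove using d by auto
  fix a assume a: "a \<in> R" "a \<bullet> v \<in> \<int>"
  obtain k :: int where k: "a \<bullet> v = k" using a(2) by (auto elim: Ints_cases)
  have fl: "\<lfloor>a \<bullet> c\<rfloor> = bd a - 1" using bd_strict[OF a(1)] by linarith
  note bounds = closed_cell_bounds[OF in1 a(1)] closed_cell_bounds[OF in2 a(1)] closed_cell_bounds[OF v(2) a(1)]
  have "k = bd a \<or> k = bd a - 1" using bounds(5,6) k fl by linarith
  then have "?e * (a \<bullet> w) = 0" using bounds(1-4) k fl by (auto simp: inner_add_right inner_diff_right)
  then show "a \<bullet> w = 0" using d(1) by simp
qed

lemma inactive_facet:
  assumes v: "v \<in> verts R" "v \<in> closed_cell R c"
  shows "\<exists>b\<in>B. b \<bullet> v < of_int (bd b)"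
proof (rule ccontr)
  assume n: "\<not> (\<exists>b\<in>B. b \<bullet> v < of_int (bd b))"
  have "b \<bullet> (c - v) \<le> 0" if "b \<in> B" for b
    using n bd_strict[of b] B_R that by (force simp: inner_diff_right)
  then have "c - v = 0" by (rule orthogonal_base_zero)
  moreover have "B \<noteq> {}"
    using orthogonal_base_zero by (metis empty_iff nonempty_Basis nonzero_Basis ex_in_conv)
  then obtain b where "b \<in> B" by blast
  ultimately show False using bd_strict[of b] B_R n by auto
qed

text \<open>
  The normals of the facets through a vertex span the space. If the facet of \<open>b\<close> does not contain it,
  they form a subset of the independent set \<open>B - {b}\<close>, hence are all of it.
\<close>

lemma vertex_unique_inactive:
  assumes u: "u \<in> verts R" "u \<in> closed_cell R c" and v: "v \<in> verts R" "v \<in> closed_cell R c"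
    and b: "b \<in> B" "b \<bullet> u < of_int (bd b)" "b \<bullet> v < of_int (bd b)"
  shows "u = v"
proof -
  have act: "a \<bullet> x = of_int (bd a)"
    if x: "x \<in> verts R" "x \<in> closed_cell R c" "b \<bullet> x < of_int (bd b)" and a: "a \<in> B - {b}" for x a
  proof (rule ccontr)
    assume na: "a \<bullet> x \<noteq> of_int (bd a)"
    let ?A = "{b \<in> B. b \<bullet> x = of_int (bd b)}"
    have "span ?A = UNIV"
    proof (rule ccontr)
      assume "span ?A \<noteq> UNIV"
      then obtain w where w: "w \<noteq> 0" "\<forall>y\<in>span ?A. w \<bullet> y = 0" using span_not_UNIV_orthogonal by blast
      then have "w = 0" by (intro active_rigid[OF x(1,2)]) (simp add: inner_commute span_base)
      then show False using w by simp
    qed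
    moreover have "?A \<subseteq> B - {b} - {a}" using x na by auto
    ultimately have "a \<in> span (B - {b} - {a})" using span_mono by blast
    then show False using independent_facets[OF b(1)] a unfolding dependent_def by blast
  qed
  have "u - v = 0"
  proof (rule active_rigid[OF u])
    fix a assume a: "a \<in> B" "a \<bullet> u = of_int (bd a)"
    then have "a \<in> B - {b}" using b by auto
    then show "a \<bullet> (u - v) = 0" using act[OF u b(2)] act[OF v b(3)] by (simp add: inner_diff_right)
  qed
  then show ?thesis by simp
qed

lemma alcove_opposite_wall:
  assumes v: "v \<in> verts R" "v \<in> closed_cell R c"
  shows "\<exists>i. sv R v i \<noteq> Zero \<and> (\<forall>u\<in>verts R. u \<in> closed_cell R c \<longrightarrow> u \<noteq> v \<longrightarrow> sv R u i = Zero)"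
proof -
  obtain b where b: "b \<in> B" "b \<bullet> v < of_int (bd b)" using inactive_facet[OF v] by blast
  have "b \<bullet> u = of_int (bd b)" if u: "u \<in> verts R" "u \<in> closed_cell R c" "u \<noteq> v" for u
    using vertex_unique_inactive[OF u(1,2) v b(1) _ b(2)] u b(1) in_closed_alcove by force
  then show ?thesis using b B_R by (intro exI[of _ "(b, bd b)"]) (auto simp: sv_Zero_iff)
qed

end

context root_arrangement
begin

lemma alcove_base:
  assumes gen: "\<And>a. a \<in> R \<Longrightarrow> a \<bullet> c \<notin> \<int>"
  shows "\<exists>B. alcove R c B"
proof -
  let ?P = "\<lambda>B. B \<subseteq> R \<and> {x. \<forall>a\<in>B. a \<bullet> x \<le> of_int \<lceil>a \<bullet> c\<rceil>} = closed_cell R c"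
  have "?P R" using closed_cell_le by auto
  then obtain B where B: "?P B" and min: "\<And>B'. ?P B' \<Longrightarrow> card B \<le> card B'"
    using ex_has_least_nat[of ?P R card] by blast
  have "alcove R c B"
  proof
    show "a \<bullet> c \<notin> \<int>" if "a \<in> R" for a using gen that .
    show "B \<subseteq> R" "{x. \<forall>a\<in>B. a \<bullet> x \<le> of_int \<lceil>a \<bullet> c\<rceil>} = closed_cell R c" using B by auto
    fix b assume b: "b \<in> B"
    show "{x. \<forall>a\<in>B - {b}. a \<bullet> x \<le> of_int \<lceil>a \<bullet> c\<rceil>} \<noteq> closed_cell R c"
    proof
      assume "{x. \<forall>a\<in>B - {b}. a \<bullet> x \<le> of_int \<lceil>a \<bullet> c\<rceil>} = closed_cell R c"
      then have "card B \<le> card (B - {b})" using B by (intro min) auto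
      moreover have "finite B" using B finite_R finite_subset by blast
      ultimately show False using b by (metis card_Diff1_less not_le)
    qed
  qed
  then show ?thesis by blast
qed

lemma root_opposite_wall:
  assumes v: "v \<in> verts R" "sle (sv R v) (sv R p)"
  shows "\<exists>i. sv R v i \<noteq> Zero \<and> (\<forall>u\<in>verts R. sle (sv R u) (sv R p) \<longrightarrow> u \<noteq> v \<longrightarrow> sv R u i = Zero)"
proof -
  obtain c where c: "sle (sv R p) (sv R c)" "\<And>a. a \<in> R \<Longrightarrow> a \<bullet> c \<notin> \<int>"
    using generic_coface by blast
  obtain B where "alcove R c B" using alcove_base[OF c(2)] by blast
  then interpret alcove R c B .
  have "x \<in> closed_cell R c" if "sle (sv R x) (sv R p)" for x
    using sle_trans[OF that c(1)] by (simp add: closed_cell_def)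
  then show ?thesis using alcove_opposite_wall[OF v(1)] v(2) by blast
qed

end

section \<open>Half-integrality for the classical root systems\<close>

lemma lookup_scaleR_coords: "Poly_Mapping.lookup (r *\<^sub>R u :: coords) i = r * Poly_Mapping.lookup u i"
proof -
  have "finite {i. r *\<^sub>R Poly_Mapping.lookup u i \<noteq> 0}"
    by (rule finite_subset[OF _ finite_lookup[of u]]) auto
  then show ?thesis by (simp add: scaleR_poly_mapping_def)
qed

lemma linear_coordinate_sum:
  fixes s :: "nat \<Rightarrow> real"
  shows "linear (\<lambda>u::coords. \<Sum>i\<le>n. Poly_Mapping.lookup u i * s i)"
proof (rule linearI)
  fix u v :: coords and r :: real
  show "(\<Sum>i\<le>n. Poly_Mapping.lookup (u + v) i * s i) =
     (\<Sum>i\<le>n. Poly_Mapping.lookup u i * s i) + (\<Sum>i\<le>n. Poly_Mapping.lookup v i * s i)"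
    by (simp add: lookup_add distrib_right sum.distrib)
  show "(\<Sum>i\<le>n. Poly_Mapping.lookup (r *\<^sub>R u) i * s i) = r *\<^sub>R (\<Sum>i\<le>n. Poly_Mapping.lookup u i * s i)"
    by (simp add: lookup_scaleR_coords sum_distrib_left mult.assoc)
qed

lemma ex_linear_coordinates:
  fixes s :: "nat \<Rightarrow> real"
  shows "\<exists>h::coords \<Rightarrow> real. linear h \<and> (\<forall>i\<le>n. h (unit_vec i) = s i)"
proof (intro exI conjI allI impI)
  show "linear (\<lambda>u::coords. \<Sum>i\<le>n. Poly_Mapping.lookup u i * s i)" by (rule linear_coordinate_sum)
  fix i assume "i \<le> n"
  then show "(\<Sum>j\<le>n. Poly_Mapping.lookup (unit_vec i) j * s j) = s i"
    by (simp add: unit_vec_def lookup_single when_def if_distrib[of "\<lambda>x. x * _"] cong: if_cong)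
qed

text \<open>
  Every linear form on the coordinate space that vanishes on the roots at which \<open>f\<close> is integral
  vanishes on all roots. This expresses, without reference to spans, that \<open>f\<close> is the evaluation of
  the roots at a vertex.
\<close>

definition integrally_spanned :: "coords set \<Rightarrow> (coords \<Rightarrow> real) \<Rightarrow> bool" where
  "integrally_spanned M f \<longleftrightarrow>
    (\<forall>h::coords \<Rightarrow> real. linear h \<longrightarrow> (\<forall>m\<in>M. f m \<in> \<int> \<longrightarrow> h m = 0) \<longrightarrow> (\<forall>m\<in>M. h m = 0))"

text \<open>
  Type A: the indices whose coordinates differ from a given one by an integer form a class whose
  indicator function kills all integral roots; so there is only one class.
\<close>

lemma integral_A:
  assumes f: "linear f" and sp: "integrally_spanned (roots_A n) f" and m: "m \<in> roots_A n"
  shows "f m \<in> \<int>"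
proof -
  obtain i j where ij: "m = unit_vec i - unit_vec j" "i \<le> n" "j \<le> n" "i \<noteq> j"
    using m unfolding roots_A_def by blast
  let ?x = "\<lambda>i. f (unit_vec i)"
  let ?s = "\<lambda>l. if ?x l - ?x i \<in> \<int> then 1 else 0 :: real"
  obtain h :: "coords \<Rightarrow> real" where h: "linear h" "\<forall>l\<le>n. h (unit_vec l) = ?s l"
    using ex_linear_coordinates[of n ?s] by blast
  have "h m' = 0" if m': "m' \<in> roots_A n" "f m' \<in> \<int>" for m'
  proof -
    obtain p q where pq: "m' = unit_vec p - unit_vec q" "p \<le> n" "q \<le> n"
      using m' unfolding roots_A_def by blast
    have d: "?x p - ?x q \<in> \<int>" using m'(2) pq f by (simp add: linear_diff)
    have "?x p - ?x i \<in> \<int> \<longleftrightarrow> ?x q - ?x i \<in> \<int>"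
    proof
      assume "?x p - ?x i \<in> \<int>"
      from Ints_diff[OF this d] show "?x q - ?x i \<in> \<int>" by simp
    next
      assume "?x q - ?x i \<in> \<int>"
      from Ints_add[OF this d] show "?x p - ?x i \<in> \<int>" by simp
    qed
    then show ?thesis using pq h by (simp add: linear_diff)
  qed
  then have "h m = 0" using sp h(1) m unfolding integrally_spanned_def by blast
  then have "?s j = 1" using ij h by (simp add: linear_diff)
  then have "?x j - ?x i \<in> \<int>" by (simp split: if_splits)
  then have "- (?x j - ?x i) \<in> \<int>" by (rule Ints_minus)
  then show ?thesis using ij f by (simp add: linear_diff)
qed

text \<open>
  Types B, C and D: suppose \<open>2 x\<^sub>i\<close> is not an integer. Then for each \<open>l\<close> at most one of \<open>x\<^sub>l - x\<^sub>i\<close> and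
  \<open>x\<^sub>l + x\<^sub>i\<close> is an integer. The linear form with coefficient \<open>1\<close> in the first case, \<open>-1\<close> in the
  second case and \<open>0\<close> otherwise kills all integral roots, but not all roots of type D.
\<close>

lemma half_integral_coordinates:
  fixes M :: "coords set"
  assumes f: "linear f" and sp: "integrally_spanned M f" and n: "n \<ge> 2"
    and MD: "roots_D n \<subseteq> M" and M: "M \<subseteq> roots_D n \<union> {r *\<^sub>R unit_vec i | r i. r \<in> {1, -1, 2, -2} \<and> i < n}"
    and i: "i < n"
  shows "2 * f (unit_vec i) \<in> \<int>"
proof (rule ccontr)
  assume ni: "2 * f (unit_vec i) \<notin> \<int>"
  let ?x = "\<lambda>i. f (unit_vec i)"
  let ?s = "\<lambda>l. if ?x l - ?x i \<in> \<int> then 1 else if ?x l + ?x i \<in> \<int> then -1 else 0 :: real"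
  obtain h :: "coords \<Rightarrow> real" where h: "linear h" "\<forall>l\<le>n. h (unit_vec l) = ?s l"
    using ex_linear_coordinates[of n ?s] by blast
  have hs: "h (unit_vec l) = ?s l" if "l < n" for l using h(2) that by simp
  have sD: "\<not> (?x l - ?x i \<in> \<int> \<and> ?x l + ?x i \<in> \<int>)" for l
  proof
    assume "?x l - ?x i \<in> \<int> \<and> ?x l + ?x i \<in> \<int>"
    then have "(?x l + ?x i) - (?x l - ?x i) \<in> \<int>" using Ints_diff by blast
    then show False using ni by simp
  qed
  have kill: "h m = 0" if m: "m \<in> M" "f m \<in> \<int>" for m
  proof (cases "m \<in> roots_D n")
    case True
    then obtain s t p q where pq: "m = s *\<^sub>R unit_vec p + t *\<^sub>R unit_vec q"
      "s \<in> {1, -1}" "t \<in> {1, -1}" "p < q" "q < n"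
      unfolding roots_D_def by blast
    have fm: "s * ?x p + t * ?x q \<in> \<int>" using m(2) pq f by (simp add: linear_add linear_cmul)
    have hm: "h m = s * ?s p + t * ?s q" using pq h(1) hs by (simp add: linear_add linear_cmul)
    have eq: "?x p + ?x q \<in> \<int> \<Longrightarrow> ?s p + ?s q = 0"
    proof -
      assume a: "?x p + ?x q \<in> \<int>"
      have "?x p - ?x i \<in> \<int> \<longleftrightarrow> ?x q + ?x i \<in> \<int>"
      proof
        assume "?x p - ?x i \<in> \<int>"
        from Ints_diff[OF a this] show "?x q + ?x i \<in> \<int>" by simp
      next
        assume "?x q + ?x i \<in> \<int>"
        from Ints_diff[OF a this] show "?x p - ?x i \<in> \<int>" by simp
      qed
      moreover have "?x q - ?x i \<in> \<int> \<longleftrightarrow> ?x p + ?x i \<in> \<int>"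
      proof
        assume "?x q - ?x i \<in> \<int>"
        from Ints_diff[OF a this] show "?x p + ?x i \<in> \<int>" by simp
      next
        assume "?x p + ?x i \<in> \<int>"
        from Ints_diff[OF a this] show "?x q - ?x i \<in> \<int>" by simp
      qed
      ultimately show ?thesis using sD[of p] sD[of q] by auto
    qed
    have eq': "?x p - ?x q \<in> \<int> \<Longrightarrow> ?s p = ?s q"
    proof -
      assume a: "?x p - ?x q \<in> \<int>"
      have "?x p - ?x i \<in> \<int> \<longleftrightarrow> ?x q - ?x i \<in> \<int>"
      proof
        assume "?x p - ?x i \<in> \<int>"
        from Ints_diff[OF this a] show "?x q - ?x i \<in> \<int>" by simp
      next
        assume "?x q - ?x i \<in> \<int>"
        from Ints_add[OF this a] show "?x p - ?x i \<in> \<int>" by simp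
      qed
      moreover have "?x p + ?x i \<in> \<int> \<longleftrightarrow> ?x q + ?x i \<in> \<int>"
      proof
        assume "?x p + ?x i \<in> \<int>"
        from Ints_diff[OF this a] show "?x q + ?x i \<in> \<int>" by (simp add: add.commute)
      next
        assume "?x q + ?x i \<in> \<int>"
        from Ints_add[OF this a] show "?x p + ?x i \<in> \<int>" by (simp add: algebra_simps)
      qed
      ultimately show ?thesis by simp
    qed
    consider "s = 1" "t = 1" | "s = 1" "t = -1" | "s = -1" "t = 1" | "s = -1" "t = -1" using pq by blast
    then show ?thesis
    proof cases
      case 1 then show ?thesis using fm hm eq by simp
    next
      case 2 then show ?thesis using fm hm eq' by simp
    next
      case 3
      then have "?x p - ?x q \<in> \<int>" using Ints_minus[OF fm] by simp
      from eq'[OF this] show ?thesis using 3 hm by simp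
    next
      case 4
      then have "?x p + ?x q \<in> \<int>" using Ints_minus[OF fm] by (simp add: add.commute)
      from eq[OF this] show ?thesis using 4 hm by simp
    qed
  next
    case False
    then obtain r l where l: "m = r *\<^sub>R unit_vec l" "r \<in> {1, -1, 2, -2}" "l < n" using M m by blast
    have fm: "r * ?x l \<in> \<int>" using m(2) l f by (simp add: linear_cmul)
    have two: "2 * ?x l \<in> \<int>"
    proof -
      have "2 * (r * ?x l) \<in> \<int>" by (rule Ints_mult[OF _ fm]) simp
      from this fm Ints_minus[OF this] Ints_minus[OF fm] show ?thesis using l(2) by auto
    qed
    have "\<not> ?x l - ?x i \<in> \<int>"
    proof
      assume a: "?x l - ?x i \<in> \<int>"
      have "2 * ?x l - 2 * (?x l - ?x i) \<in> \<int>" by (rule Ints_diff[OF two Ints_mult[OF _ a]]) simp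
      then show False using ni by (simp add: algebra_simps)
    qed
    moreover have "\<not> ?x l + ?x i \<in> \<int>"
    proof
      assume a: "?x l + ?x i \<in> \<int>"
      have "2 * (?x l + ?x i) - 2 * ?x l \<in> \<int>" by (rule Ints_diff[OF Ints_mult[OF _ a] two]) simp
      then show False using ni by (simp add: algebra_simps)
    qed
    ultimately show ?thesis using l h(1) hs by (simp add: linear_cmul)
  qed
  have zero: "h m = 0" if "m \<in> M" for m
    using sp h(1) kill that unfolding integrally_spanned_def by blast
  obtain j where j: "j < n" "j \<noteq> i" 
    using n i that[of 0] that[of 1] by (cases "i = 0") auto
  define p where "p = min i j"
  define q where "q = max i j"
  have "p < q" "q < n" using i j by (auto simp: p_def q_def)
  then have "unit_vec p + unit_vec q \<in> roots_D n" "unit_vec p - unit_vec q \<in> roots_D n"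
  proof -
    assume pq: "p < q" "q < n"
    have "1 *\<^sub>R unit_vec p + 1 *\<^sub>R unit_vec q \<in> roots_D n" "1 *\<^sub>R unit_vec p + (-1) *\<^sub>R unit_vec q \<in> roots_D n"
      unfolding roots_D_def using pq by blast+
    then show "unit_vec p + unit_vec q \<in> roots_D n" "unit_vec p - unit_vec q \<in> roots_D n" by simp_all
  qed
  then have "h (unit_vec p) + h (unit_vec q) = 0" "h (unit_vec p) - h (unit_vec q) = 0"
    using zero MD h(1) by (metis linear_add linear_diff subsetD)+
  then have "h (unit_vec p) = 0" "h (unit_vec q) = 0" by linarith+
  then have "h (unit_vec i) = 0" unfolding p_def q_def by (auto simp: min_def max_def split: if_splits)
  then show False using hs i by simp
qed

lemma half_integral_BCD:
  fixes M :: "coords set"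
  assumes f: "linear f" and sp: "integrally_spanned M f" and n: "n \<ge> 2"
    and MD: "roots_D n \<subseteq> M" and M: "M \<subseteq> roots_D n \<union> {r *\<^sub>R unit_vec i | r i. r \<in> {1, -1, 2, -2} \<and> i < n}"
    and m: "m \<in> M"
  shows "2 * f m \<in> \<int>"
proof -
  have int: "2 * f (unit_vec i) \<in> \<int>" if "i < n" for i
    using half_integral_coordinates[OF f sp n MD M that] .
  show ?thesis
  proof (cases "m \<in> roots_D n")
    case True
    then obtain s t p q where pq: "m = s *\<^sub>R unit_vec p + t *\<^sub>R unit_vec q"
      "s \<in> {1, -1}" "t \<in> {1, -1}" "p < q" "q < n"
      unfolding roots_D_def by blast
    have "2 * f m = s * (2 * f (unit_vec p)) + t * (2 * f (unit_vec q))"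
      using pq f by (simp add: linear_add linear_cmul algebra_simps)
    also have "\<dots> \<in> \<int>"
    proof -
      have "s \<in> \<int>" "t \<in> \<int>" "p < n" using pq by auto
      then show ?thesis using Ints_add[OF Ints_mult[OF _ int] Ints_mult[OF _ int]] pq(5) by blast
    qed
    finally show ?thesis .
  next
    case False
    then obtain r l where l: "m = r *\<^sub>R unit_vec l" "r \<in> {1, -1, 2, -2}" "l < n" using M m by blast
    have "2 * f m = r * (2 * f (unit_vec l))" using l f by (simp add: linear_cmul)
    also have "\<dots> \<in> \<int>" by (rule Ints_mult[OF _ int[OF l(3)]]) (use l(2) in auto)
    finally show ?thesis .
  qed
qed

lemma half_integral_classical:
  assumes f: "linear f" and sp: "integrally_spanned M f" and m: "m \<in> M"
    and M: "(\<exists>n. M = roots_A n) \<or> (\<exists>n\<ge>2. M = roots_B n \<or> M = roots_C n \<or> M = roots_D n)"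
  shows "2 * f m \<in> \<int>"
  using M
proof
  assume "\<exists>n. M = roots_A n"
  then show ?thesis using integral_A[OF f] sp m by (intro Ints_mult) auto
next
  assume "\<exists>n\<ge>2. M = roots_B n \<or> M = roots_C n \<or> M = roots_D n"
  then obtain n where n: "n \<ge> 2" "M = roots_B n \<or> M = roots_C n \<or> M = roots_D n" by blast
  show ?thesis
    by (rule half_integral_BCD[OF f sp n(1) _ _ m]) (use n(2) in \<open>auto simp: roots_B_def roots_C_def\<close>)
qed

section \<open>Convex subcomplexes\<close>

context simplicial_arrangement
begin

text \<open>
  The union of the full cells is closed because the arrangement is locally finite. A segment between two of
  its points cannot leave it: from the last point \<open>x\<close> up to which it has not left, the product with the
  cell of the end point leads further.
\<close>

lemma convex_full_faces:
  assumes prod: "\<And>s t. s \<in> full_faces R D \<Longrightarrow> t \<in> full_faces R D \<Longrightarrow> smul s t \<in> full_faces R D"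
  shows "convex {x. sv R x \<in> full_faces R D}"
proof -
  let ?P = "{x. sv R x \<in> full_faces R D}"
  have sv_faces: "sv R x \<in> faces R" for x by (simp add: faces_def)
  have "open (- ?P)"
  proof (subst open_subopen, rule ballI)
    fix p assume p: "p \<in> - ?P"
    obtain U where U: "open U" "p \<in> U" "\<forall>x\<in>U. sle (sv R p) (sv R x)"
      using eventually_sle[of p] unfolding eventually_nhds by blast
    have "x \<in> - ?P" if "x \<in> U" for x
    proof
      assume "x \<in> ?P"
      then have "sv R x \<in> full_faces R D" by simp
      from full_faces_below[OF this sv_faces] have "sv R p \<in> full_faces R D" using U(3) that by metis
      then show False using p by simp
    qed
    then have "U \<subseteq> - ?P" by blast
    then show "\<exists>U. open U \<and> p \<in> U \<and> U \<subseteq> - ?P" using U by blast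
  qed
  then have cl: "closed ?P" by (simp add: closed_def)
  have seg: "x + r *\<^sub>R (y - x) \<in> ?P" if xy: "x \<in> ?P" "y \<in> ?P" and r: "0 \<le> r" "r \<le> 1" for x y r
  proof (rule ccontr)
    assume nr: "x + r *\<^sub>R (y - x) \<notin> ?P"
    let ?z = "\<lambda>t. x + t *\<^sub>R (y - x)"
    let ?A = "{0..r} \<inter> ?z -` ?P"
    have "closed ?A"
      by (intro closed_Int continuous_closed_vimage cl) (auto intro!: continuous_intros)
    moreover have "?A \<noteq> {}" using xy r by (auto intro!: exI[of _ 0])
    moreover have bdd: "bdd_above ?A" by (rule bdd_above_mono[of "{0..r}"]) auto
    ultimately have s: "Sup ?A \<in> ?A" by (rule closed_contains_Sup[rotated 2])
    define s where "s = Sup ?A"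
    have s: "0 \<le> s" "s < r" "?z s \<in> ?P" using s nr unfolding s_def[symmetric] by (auto simp: order_less_le)
    obtain e where e: "e > 0" "e < r - s"
      "sv R (?z s + e *\<^sub>R (y - ?z s)) = smul (sv R (?z s)) (sv R y)"
      using product_point[of "r - s" "?z s" y] s by auto
    have "?z s + e *\<^sub>R (y - ?z s) = ?z (s + e * (1 - s))" by (simp add: algebra_simps)
    then have "sv R (?z (s + e * (1 - s))) = smul (sv R (?z s)) (sv R y)" using e(3) by metis
    moreover have "smul (sv R (?z s)) (sv R y) \<in> full_faces R D" using prod s xy by blast
    ultimately have zP: "?z (s + e * (1 - s)) \<in> ?P" by simp
    have pos: "e * (1 - s) > 0" using e s r by simp
    have "e * (1 - s) \<le> e * 1" using e s by (intro mult_left_mono) auto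
    then have "0 \<le> s + e * (1 - s)" "s + e * (1 - s) \<le> r" using pos s(1) e(2) by linarith+
    then have "s + e * (1 - s) \<in> ?A" using zP by (simp only: Int_iff atLeastAtMost_iff vimage_eq)
    then have "s + e * (1 - s) \<le> s" unfolding s_def using bdd by (rule cSup_upper)
    then show False using pos by simp
  qed
  show ?thesis
    unfolding convex_alt
  proof (intro ballI allI impI)
    fix x y u assume *: "x \<in> ?P" "y \<in> ?P" "0 \<le> u \<and> (u::real) \<le> 1"
    have "(1 - u) *\<^sub>R x + u *\<^sub>R y = x + u *\<^sub>R (y - x)" by (simp add: algebra_simps)
    then show "(1 - u) *\<^sub>R x + u *\<^sub>R y \<in> ?P" using seg[of x y u] * by simp
  qed
qed

text \<open>
  A convex subcomplex is determined by its vertices, since each face is a product of vertices.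
\<close>

lemma closed_family_eq_full_faces:
  assumes F: "F \<subseteq> faces R" and down: "\<And>s t. t \<in> F \<Longrightarrow> s \<in> faces R \<Longrightarrow> sle s t \<Longrightarrow> s \<in> F"
    and prod: "\<And>s t. s \<in> F \<Longrightarrow> t \<in> F \<Longrightarrow> smul s t \<in> F"
    and ne: "F \<noteq> {}"
    and D: "D = {v \<in> verts R. sv R v \<in> F}"
  shows "F = full_faces R D"
proof
  show "F \<subseteq> full_faces R D"
  proof
    fix s assume s: "s \<in> F"
    have "v \<in> D" if "v \<in> verts R" "sle (sv R v) s" for v
      using that down[OF s, of "sv R v"] unfolding D faces_def by blast
    then show "s \<in> full_faces R D" using s F unfolding full_faces_def by blast
  qed
  show "full_faces R D \<subseteq> F"
  proof
    fix s assume s: "s \<in> full_faces R D"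
    have sF: "s \<in> faces R" using s unfolding full_faces_def by blast
    show "s \<in> F"
    proof (cases "s = szero")
      case True
      obtain t where "t \<in> F" using ne by blast
      then show ?thesis using down[of t szero] True by (simp add: sle_def szero_def faces_def)
    next
      case False
      have sup: "\<exists>x\<in>F. (\<exists>v\<in>verts R. x = sv R v) \<and> sle x s \<and> x i \<noteq> Zero" if "s i \<noteq> Zero" for i
        using face_support[OF sF that] s unfolding full_faces_def D by blast
      from False obtain i where "s i \<noteq> Zero" unfolding szero_def by blast
      from sup[OF this] obtain v where v: "sv R v \<in> F" "sle (sv R v) s" by blast
      show ?thesis
      proof (rule product_cover[where g = "sv R v"])
        show "finite {i. sv R v i = Zero \<and> s i \<noteq> Zero}"
          using finite_zeros_above_vertex[OF sle_refl sF] .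
      qed (use prod v sup in blast)+
    qed
  qed
qed

end

section \<open>The Coxeter complex in terms of sign vectors\<close>

lemma riesz_inner: "blinfun_apply p x = riesz p \<bullet> (x::'a::euclidean_space)"
proof -
  let ?v = "adjoint (blinfun_apply p) 1"
  have "linear (blinfun_apply p)" by (simp add: blinfun.bounded_linear_right bounded_linear.linear)
  then have v: "\<forall>x. blinfun_apply p x = ?v \<bullet> x"
    using adjoint_works[of "blinfun_apply p" _ 1] by (simp add: inner_commute)
  have "riesz p = ?v"
    unfolding riesz_def
  proof (rule the_equality)
    fix w assume "\<forall>x. blinfun_apply p x = w \<bullet> x"
    then have "\<forall>x. w \<bullet> x = ?v \<bullet> x" using v by simp
    then show "w = ?v" by (simp add: vector_eq_rdot)
  qed (use v in blast)
  then show ?thesis using v by simp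
qed

lemma riesz_eqI: "(\<And>x. blinfun_apply p x = v \<bullet> x) \<Longrightarrow> riesz p = v"
  by (metis riesz_inner vector_eq_rdot)

lemma linear_riesz: "linear (riesz :: 'a::euclidean_space dual \<Rightarrow> 'a)"
proof (rule linearI)
  fix p q :: "'a dual" and r :: real
  show "riesz (p + q) = riesz p + riesz q"
    by (rule riesz_eqI) (simp only: blinfun.add_left, simp only: riesz_inner inner_add_left)
  show "riesz (r *\<^sub>R p) = r *\<^sub>R riesz p"
    by (rule riesz_eqI) (simp only: blinfun.scaleR_left, simp only: riesz_inner inner_scaleR_left real_scaleR_def)
qed

lemma riesz_simps:
  fixes p :: "'a::euclidean_space dual"
  shows "riesz (- p) = - riesz p" "riesz (r *\<^sub>R p) = r *\<^sub>R riesz p"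
    "riesz (p - q) = riesz p - riesz q" "riesz 0 = (0::'a)"
  using linear_neg[OF linear_riesz] linear_cmul[OF linear_riesz] linear_diff[OF linear_riesz]
    linear_0[OF linear_riesz] by blast+

lemma inj_riesz: "inj (riesz :: 'a::euclidean_space dual \<Rightarrow> 'a)"
  by (rule injI, rule blinfun_eqI) (simp add: riesz_inner)

lemma riesz_inner_left: "riesz (blinfun_inner_left v) = (v::'a::euclidean_space)"
  by (rule riesz_eqI) (simp add: inner_commute)

lemma inner_left_riesz: "blinfun_inner_left (riesz p) = (p :: 'a::euclidean_space dual)"
  by (rule injD[OF inj_riesz]) (simp add: riesz_inner_left)

lemma apply_coroot: "blinfun_apply p (coroot q) = 2 * (riesz p \<bullet> riesz q) / (riesz q \<bullet> riesz q)"
  unfolding riesz_inner coroot_def dual_inner_def by simp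

lemma riesz_reflection:
  "riesz (reflection q p) = riesz p - (2 * (riesz p \<bullet> riesz q) / (riesz q \<bullet> riesz q)) *\<^sub>R riesz q"
  unfolding reflection_def apply_coroot by (simp add: riesz_simps)

lemma root_arrangement_riesz:
  fixes \<Phi> :: "'a::euclidean_space dual set"
  assumes rs: "root_system \<Phi>" and es: "essential \<Phi>" and ir: "irreducible_roots \<Phi>"
  shows "root_arrangement (riesz ` \<Phi>)"
proof
  let ?R = "riesz ` \<Phi>"
  show "finite ?R" using rs unfolding root_system_def by blast
  have line: "range (\<lambda>c. c *\<^sub>R \<alpha>) \<inter> \<Phi> = {\<alpha>, - \<alpha>}" if "\<alpha> \<in> \<Phi>" for \<alpha>
    using rs that unfolding root_system_def by blast
  have minus: "- \<alpha> \<in> \<Phi>" if "\<alpha> \<in> \<Phi>" for \<alpha> using line[OF that] by blast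
  show "- a \<in> ?R" if "a \<in> ?R" for a
    using that minus by (auto simp: riesz_simps(1)[symmetric])
  have "range (riesz :: 'a dual \<Rightarrow> 'a) = UNIV" using riesz_inner_left by (metis surjI)
  then show "span ?R = UNIV"
    using es linear_span_image[OF linear_riesz, of \<Phi>] unfolding essential_def by simp
  show "0 \<notin> ?R"
  proof
    assume "0 \<in> ?R"
    then obtain \<alpha> where "\<alpha> \<in> \<Phi>" "riesz \<alpha> = riesz 0" unfolding riesz_simps by auto
    then show False using injD[OF inj_riesz] rs unfolding root_system_def by blast
  qed
  show "b - (2 * (b \<bullet> a) / (a \<bullet> a)) *\<^sub>R a \<in> ?R" if R: "a \<in> ?R" "b \<in> ?R" for a b
  proof -
    obtain \<alpha> \<beta> where ab: "\<alpha> \<in> \<Phi>" "a = riesz \<alpha>" "\<beta> \<in> \<Phi>" "b = riesz \<beta>" using R by blast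
    have "reflection \<alpha> \<beta> \<in> \<Phi>" using rs ab unfolding root_system_def by blast
    then show ?thesis using riesz_reflection[of \<alpha> \<beta>] ab by (metis imageI)
  qed
  show "2 * (b \<bullet> a) / (a \<bullet> a) \<in> \<int>" if R: "a \<in> ?R" "b \<in> ?R" for a b
  proof -
    obtain \<alpha> \<beta> where ab: "\<alpha> \<in> \<Phi>" "a = riesz \<alpha>" "\<beta> \<in> \<Phi>" "b = riesz \<beta>" using R by blast
    have "blinfun_apply \<beta> (coroot \<alpha>) \<in> \<int>" using rs ab unfolding root_system_def by blast
    then show ?thesis unfolding apply_coroot ab .
  qed
  show "r *\<^sub>R a = a \<or> r *\<^sub>R a = - a" if R: "a \<in> ?R" "r *\<^sub>R a \<in> ?R" for a r
  proof -
    obtain \<alpha> \<beta> where ab: "\<alpha> \<in> \<Phi>" "a = riesz \<alpha>" "\<beta> \<in> \<Phi>" "r *\<^sub>R a = riesz \<beta>" using R by blast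
    have "riesz (r *\<^sub>R \<alpha>) = riesz \<beta>" using ab by (simp add: riesz_simps)
    then have "r *\<^sub>R \<alpha> = \<beta>" by (rule injD[OF inj_riesz])
    then have "r *\<^sub>R \<alpha> = \<alpha> \<or> r *\<^sub>R \<alpha> = - \<alpha>" using line[OF ab(1)] ab(3) by blast
    then show ?thesis using ab(2) riesz_simps(2)[of r \<alpha>] riesz_simps(1)[of \<alpha>] by metis
  qed
  fix S T assume ST: "S \<union> T = ?R" "S \<inter> T = {}" "\<And>a b. a \<in> S \<Longrightarrow> b \<in> T \<Longrightarrow> a \<bullet> b = 0"
  let ?S = "{\<alpha> \<in> \<Phi>. riesz \<alpha> \<in> S}" and ?T = "{\<alpha> \<in> \<Phi>. riesz \<alpha> \<in> T}"
  have "?S \<inter> ?T = {}" "?S \<union> ?T = \<Phi>" "\<forall>\<alpha>\<in>?S. \<forall>\<beta>\<in>?T. dual_inner \<alpha> \<beta> = 0"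
    using ST unfolding dual_inner_def by blast+
  with ir[unfolded irreducible_roots_def not_ex, rule_format, of ?S ?T]
  have "?S = {} \<or> ?T = {}" by argo
  moreover have sub: "S \<subseteq> riesz ` ?S" "T \<subseteq> riesz ` ?T" using ST(1) by auto
  moreover have "S = {}" if "?S = {}" using sub(1) unfolding that by simp
  moreover have "T = {}" if "?T = {}" using sub(2) unfolding that by simp
  ultimately show "S = {} \<or> T = {}" by argo
qed

text \<open>
  The values of the roots at a vertex define a linear form on the coordinate space of the standard
  model; since a vertex is determined by the hyperplanes through it, this form is integrally spanned.
\<close>

lemma classical_half_integral:
  fixes \<Phi> :: "'a::euclidean_space dual set"
  assumes rs: "root_system \<Phi>" and es: "essential \<Phi>" and ir: "irreducible_roots \<Phi>"
    and cl: "classical_type \<Phi>"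
    and v: "v \<in> verts (riesz ` \<Phi>)" and a: "a \<in> riesz ` \<Phi>"
  shows "2 * (a \<bullet> v) \<in> \<int>"
proof -
  interpret root_arrangement "riesz ` \<Phi>" by (rule root_arrangement_riesz[OF rs es ir])
  obtain M where M: "root_iso \<Phi> M"
    "(\<exists>n. M = roots_A n) \<or> (\<exists>n\<ge>2. M = roots_B n \<or> M = roots_C n \<or> M = roots_D n)"
  proof -
    have "n \<ge> 2" if "n \<ge> 3" for n :: nat using that by simp
    then show thesis using cl that unfolding classical_type_def by metis
  qed
  then obtain T where T: "linear T" "inj_on T (span \<Phi>)" "T ` \<Phi> = M" unfolding root_iso_def by blast
  have "inj T" using T(2) es unfolding essential_def by simp
  then obtain g where g: "linear g" "g \<circ> T = id" using linear_injective_left_inverse[OF T(1)] by blast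
  have gT: "g (T \<alpha>) = \<alpha>" for \<alpha> using g(2) by (metis comp_apply id_apply)
  define f where "f m = blinfun_apply (g m) v" for m
  have f: "linear f"
    unfolding f_def by (rule linearI)
      (simp_all add: linear_add[OF g(1)] linear_cmul[OF g(1)] blinfun.add_left blinfun.scaleR_left)
  have fT: "f (T \<alpha>) = riesz \<alpha> \<bullet> v" for \<alpha> unfolding f_def gT riesz_inner ..
  have "integrally_spanned M f"
    unfolding integrally_spanned_def
  proof (intro allI impI)
    fix h :: "coords \<Rightarrow> real"
    assume h: "linear h" and k: "\<forall>m\<in>M. f m \<in> \<int> \<longrightarrow> h m = 0"
    let ?p = "\<lambda>u. h (T (blinfun_inner_left u))"
    have lin: "linear ?p"
    proof (rule linearI)
      fix x y :: 'a and r :: real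
      have "blinfun_inner_left (x + y) = blinfun_inner_left x + blinfun_inner_left y"
        by (rule blinfun_eqI) (simp add: blinfun.add_left inner_add_right)
      then show "?p (x + y) = ?p x + ?p y" by (simp add: linear_add[OF T(1)] linear_add[OF h])
      have "blinfun_inner_left (r *\<^sub>R x) = r *\<^sub>R blinfun_inner_left x"
        by (rule blinfun_eqI) (simp add: blinfun.scaleR_left)
      then show "?p (r *\<^sub>R x) = r *\<^sub>R ?p x" by (simp add: linear_cmul[OF T(1)] linear_cmul[OF h])
    qed
    define w where "w = adjoint ?p 1"
    have hw: "h (T \<alpha>) = riesz \<alpha> \<bullet> w" for \<alpha>
    proof -
      have "?p (riesz \<alpha>) = riesz \<alpha> \<bullet> w" unfolding w_def using adjoint_works[OF lin, of "riesz \<alpha>" 1] by simp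
      then show ?thesis by (simp add: inner_left_riesz)
    qed
    have "w = 0"
    proof (rule vertex_rigid[OF v])
      fix a assume "a \<in> riesz ` \<Phi>" "a \<bullet> v \<in> \<int>"
      then obtain \<alpha> where "\<alpha> \<in> \<Phi>" "a = riesz \<alpha>" "f (T \<alpha>) \<in> \<int>" using fT by auto
      then show "a \<bullet> w = 0" using k T(3) hw by (metis imageI)
    qed
    then show "\<forall>m\<in>M. h m = 0" using T(3) hw by auto
  qed
  moreover obtain \<alpha> where \<alpha>: "\<alpha> \<in> \<Phi>" "a = riesz \<alpha>" using a by blast
  ultimately have "2 * f (T \<alpha>) \<in> \<int>" using half_integral_classical[OF f _ _ M(2)] T(3) by blast
  then show ?thesis using fT \<alpha> by simp
qed

text \<open>
  The set of points with a given sign vector; it is empty for the sign vector of the empty face.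
\<close>

definition face_set :: "'a::euclidean_space set \<Rightarrow> ('a \<times> int \<Rightarrow> sign) \<Rightarrow> 'a set" where
  "face_set R s = {x. sv R x = s}"

lemma hyp_sv: "\<alpha> \<in> \<Phi> \<Longrightarrow> x \<in> hyp \<alpha> k s \<longleftrightarrow> sv (riesz ` \<Phi>) x (riesz \<alpha>, k) = s"
  by (cases s) (auto simp: sv_simp riesz_inner rsign_def)

lemma open_cells_eq: "open_cells \<Phi> = range (cell (riesz ` \<Phi>))"
proof
  have eq: "cell (riesz ` \<Phi>) p = (\<Inter>\<alpha>\<in>\<Phi>. \<Inter>k. hyp \<alpha> k (sv (riesz ` \<Phi>) p (riesz \<alpha>, k)))" for p
  proof -
    have "sv (riesz ` \<Phi>) x = sv (riesz ` \<Phi>) p \<longleftrightarrow>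
        (\<forall>\<alpha>\<in>\<Phi>. \<forall>k. sv (riesz ` \<Phi>) x (riesz \<alpha>, k) = sv (riesz ` \<Phi>) p (riesz \<alpha>, k))" for x
    proof
      assume *: "\<forall>\<alpha>\<in>\<Phi>. \<forall>k. sv (riesz ` \<Phi>) x (riesz \<alpha>, k) = sv (riesz ` \<Phi>) p (riesz \<alpha>, k)"
      show "sv (riesz ` \<Phi>) x = sv (riesz ` \<Phi>) p"
      proof
        fix i :: "'a \<times> int"
        obtain a k where "i = (a, k)" by (cases i)
        then show "sv (riesz ` \<Phi>) x i = sv (riesz ` \<Phi>) p i"
          using * by (cases "a \<in> riesz ` \<Phi>") (auto simp: sv_outside)
      qed
    qed simp
    then show ?thesis by (auto simp: cell_def hyp_sv)
  qed
  show "range (cell (riesz ` \<Phi>)) \<subseteq> open_cells \<Phi>"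
  proof
    fix A assume "A \<in> range (cell (riesz ` \<Phi>))"
    then obtain p where p: "A = cell (riesz ` \<Phi>) p" by blast
    then have "p \<in> A" by (simp add: cell_def)
    then have "A \<noteq> {}" by blast
    moreover have "A = (\<Inter>\<alpha>\<in>\<Phi>. \<Inter>k. hyp \<alpha> k (sv (riesz ` \<Phi>) p (riesz \<alpha>, k)))"
      unfolding p by (rule eq)
    ultimately show "A \<in> open_cells \<Phi>" unfolding open_cells_def
      by (intro CollectI conjI exI[of _ "\<lambda>\<alpha> k. sv (riesz ` \<Phi>) p (riesz \<alpha>, k)"])
  qed
  show "open_cells \<Phi> \<subseteq> range (cell (riesz ` \<Phi>))"
  proof
    fix A assume "A \<in> open_cells \<Phi>"
    then obtain \<sigma> p where \<sigma>: "A = (\<Inter>\<alpha>\<in>\<Phi>. \<Inter>k. hyp \<alpha> k (\<sigma> \<alpha> k))" and p: "p \<in> A"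
      unfolding open_cells_def by blast
    then have "sv (riesz ` \<Phi>) p (riesz \<alpha>, k) = \<sigma> \<alpha> k" if "\<alpha> \<in> \<Phi>" for \<alpha> k
      using hyp_sv[OF that] that by blast
    then have "A = cell (riesz ` \<Phi>) p" unfolding \<sigma> eq by auto
    then show "A \<in> range (cell (riesz ` \<Phi>))" by blast
  qed
qed

text \<open>
  The vectors \<open>R\<close> represent the linear forms in \<open>\<Phi>\<close>. Passing to sign vectors identifies the Coxeter complex
  of \<open>\<Phi>\<close> with the set of faces of the arrangement, with its order and product.
\<close>

locale coxeter_roots =
  simplicial_arrangement R for R :: "'a::euclidean_space set" +
  fixes \<Phi> :: "'a dual set"
  assumes R_eq: "R = riesz ` \<Phi>"
begin

lemma cells: "open_cells \<Phi> = range (cell R)"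
  by (simp add: R_eq open_cells_eq)

lemma face_set_szero: "face_set R szero = {}"
  using sv_ne_szero by (auto simp: face_set_def)

lemma face_set_sv: "face_set R (sv R p) = cell R p"
  by (simp add: face_set_def cell_def)

lemma complex_eq: "coxeter_complex \<Phi> = face_set R ` faces R"
  unfolding coxeter_complex_def cells faces_def
  by (simp add: face_set_szero image_image face_set_sv)

lemma face_set_nonempty: "s \<in> faces R \<Longrightarrow> s \<noteq> szero \<Longrightarrow> \<exists>p. s = sv R p \<and> face_set R s = cell R p"
  unfolding faces_def using face_set_sv by auto

lemma inj_face_set: "s \<in> faces R \<Longrightarrow> t \<in> faces R \<Longrightarrow> face_set R s = face_set R t \<longleftrightarrow> s = t"
proof
  assume st: "s \<in> faces R" "t \<in> faces R" and eq: "face_set R s = face_set R t"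
  show "s = t"
  proof (cases "s = szero")
    case True
    then have "face_set R t = {}" using eq face_set_szero by simp
    then show ?thesis using True st(2) unfolding faces_def face_set_def by auto
  next
    case False
    then obtain p where "s = sv R p" using st(1) unfolding faces_def by blast
    then have "p \<in> face_set R t" using eq by (auto simp: face_set_def)
    then show ?thesis using \<open>s = sv R p\<close> by (simp add: face_set_def)
  qed
qed simp

lemma sign_seq_face:
  assumes s: "s \<in> faces R" and \<alpha>: "\<alpha> \<in> \<Phi>"
  shows "sign_seq (face_set R s) \<alpha> k = s (riesz \<alpha>, k)"
proof (cases "s = szero")
  case True
  then show ?thesis unfolding sign_seq_def by (simp add: face_set_szero) (simp add: szero_def)
next
  case False
  then obtain p where p: "s = sv R p" using s unfolding faces_def by blast
  then have pin: "p \<in> face_set R s" by (simp add: face_set_def)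
  have "(THE t. face_set R s \<subseteq> hyp \<alpha> k t) = s (riesz \<alpha>, k)"
  proof (rule the_equality)
    show "face_set R s \<subseteq> hyp \<alpha> k (s (riesz \<alpha>, k))"
      using hyp_sv[OF \<alpha>] by (auto simp: face_set_def R_eq)
    fix t assume "face_set R s \<subseteq> hyp \<alpha> k t"
    then have "p \<in> hyp \<alpha> k t" using pin by blast
    then show "t = s (riesz \<alpha>, k)" using hyp_sv[OF \<alpha>, of p k t] p R_eq by simp
  qed
  then show ?thesis unfolding sign_seq_def using pin by auto
qed

lemma face_outside: "s \<in> faces R \<Longrightarrow> a \<notin> R \<Longrightarrow> s (a, k) = Zero"
  unfolding faces_def by (auto simp: sv_outside szero_def)

lemma cell_prod_face:
  assumes s: "s \<in> faces R" and t: "t \<in> faces R"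
  shows "cell_prod \<Phi> (face_set R s) (face_set R t) = face_set R (smul s t)"
  unfolding cell_prod_def
proof (rule the_equality)
  have st: "smul s t \<in> faces R" using faces_smul s t .
  show "face_set R (smul s t) \<in> coxeter_complex \<Phi> \<and> (\<forall>\<alpha>\<in>\<Phi>. \<forall>k. sign_seq (face_set R (smul s t)) \<alpha> k =
      (if sign_seq (face_set R s) \<alpha> k \<noteq> Zero then sign_seq (face_set R s) \<alpha> k
       else sign_seq (face_set R t) \<alpha> k))"
    unfolding complex_eq using st by (simp add: sign_seq_face s t smul_def)
  fix C assume C: "C \<in> coxeter_complex \<Phi> \<and> (\<forall>\<alpha>\<in>\<Phi>. \<forall>k. sign_seq C \<alpha> k =
      (if sign_seq (face_set R s) \<alpha> k \<noteq> Zero then sign_seq (face_set R s) \<alpha> k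
       else sign_seq (face_set R t) \<alpha> k))"
  then obtain u where u: "u \<in> faces R" "C = face_set R u" unfolding complex_eq by blast
  have "u = smul s t"
  proof
    fix i :: "'a \<times> int"
    obtain a k where i: "i = (a, k)" by (cases i)
    show "u i = smul s t i"
    proof (cases "a \<in> R")
      case True
      then obtain \<alpha> where \<alpha>: "\<alpha> \<in> \<Phi>" "a = riesz \<alpha>" unfolding R_eq by blast
      have "sign_seq C \<alpha> k = (if sign_seq (face_set R s) \<alpha> k \<noteq> Zero then sign_seq (face_set R s) \<alpha> k
         else sign_seq (face_set R t) \<alpha> k)" using C \<alpha>(1) by blast
      then show ?thesis using \<alpha> by (simp add: i u sign_seq_face s t smul_def)
    next
      case False
      then show ?thesis using face_outside u(1) st i by metis
    qed
  qed
  then show "C = face_set R (smul s t)" using u by simp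
qed

lemma cell_vertices_face:
  assumes "s \<in> faces R"
  shows "cell_vertices (face_set R s) = {v \<in> verts R. sle (sv R v) s}"
proof (cases "s = szero")
  case True
  then show ?thesis unfolding cell_vertices_def
    by (simp add: face_set_szero not_sle_szero extreme_point_of_def)
next
  case False
  then obtain p where "s = sv R p" "face_set R s = cell R p" using face_set_nonempty assms by blast
  then show ?thesis unfolding cell_vertices_def by (simp add: closure_cell extreme_points_closed_cell)
qed

lemma cell_le_face:
  assumes s: "s \<in> faces R" and t: "t \<in> faces R"
  shows "cell_le (face_set R s) (face_set R t) \<longleftrightarrow> sle s t"
proof (cases "s = szero")
  case True
  then show ?thesis by (simp add: cell_le_def face_set_szero) (simp add: sle_def szero_def)
next
  case False
  then obtain p where p: "s = sv R p" "face_set R s = cell R p" using face_set_nonempty s by blast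
  show ?thesis
  proof (cases "t = szero")
    case True
    then show ?thesis using p not_sle_szero[of p]
      by (simp add: cell_le_def face_set_szero) (auto simp: cell_def)
  next
    case False
    then obtain q where q: "t = sv R q" "face_set R t = cell R q" using face_set_nonempty t by blast
    have "closed_cell R p \<subseteq> closed_cell R q \<longleftrightarrow> sle (sv R p) (sv R q)"
    proof
      assume "closed_cell R p \<subseteq> closed_cell R q"
      moreover have "p \<in> closed_cell R p" by (simp add: closed_cell_def sle_refl)
      ultimately show "sle (sv R p) (sv R q)" unfolding closed_cell_def by auto
    qed (auto simp: closed_cell_def intro: sle_trans)
    then show ?thesis unfolding cell_le_def p(2) q(2) closure_cell unfolding p(1) q(1) .
  qed
qed

lemma vertices_eq: "vertices \<Phi> = verts R"
proof -
  have "{v} \<in> range (cell R) \<longleftrightarrow> cell R v = {v}" for v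
  proof
    assume "{v} \<in> range (cell R)"
    then obtain p where p: "cell R p = {v}" by (metis imageE)
    then have "p = v" unfolding cell_def by blast
    then show "cell R v = {v}" using p by simp
  qed (metis rangeI)
  then show ?thesis by (simp add: vertices_def verts_def cells)
qed

lemma cell_at_eq: "cell_at \<Phi> x = face_set R (sv R x)"
  unfolding cell_at_def cells
proof (rule the_equality)
  show "face_set R (sv R x) \<in> range (cell R) \<and> x \<in> face_set R (sv R x)"
    by (simp add: face_set_sv) (simp add: cell_def)
  fix A assume "A \<in> range (cell R) \<and> x \<in> A"
  then show "A = face_set R (sv R x)" by (auto simp: cell_def face_set_def)
qed

lemma induced_eq: "induced_subcomplex \<Phi> D = face_set R ` full_faces R D"
  unfolding induced_subcomplex_def complex_eq full_faces_def
  using cell_vertices_face by (auto simp: subset_iff)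

lemma lovasz_eq: "lovasz_extension \<Phi> D = {x. sv R x \<in> full_faces R D}"
proof -
  have "x \<in> face_set R s \<longleftrightarrow> s = sv R x" for x s by (auto simp: face_set_def)
  then show ?thesis unfolding lovasz_extension_def induced_eq by auto
qed

lemma convex_subcomplex_face:
  assumes F: "F \<subseteq> faces R"
  shows "convex_subcomplex \<Phi> (face_set R ` F) \<longleftrightarrow>
    F \<noteq> {} \<and> (\<forall>t\<in>F. \<forall>s\<in>faces R. sle s t \<longrightarrow> s \<in> F) \<and> (\<forall>s\<in>F. \<forall>t\<in>F. smul s t \<in> F)"
proof -
  have mem: "face_set R s \<in> face_set R ` F \<longleftrightarrow> s \<in> F" if "s \<in> faces R" for s
    using inj_face_set[OF that] F by (auto simp: image_iff)
  have sub: "face_set R ` F \<subseteq> coxeter_complex \<Phi>" unfolding complex_eq using F by blast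
  have "(\<forall>B\<in>face_set R ` F. \<forall>A\<in>coxeter_complex \<Phi>. cell_le A B \<longrightarrow> A \<in> face_set R ` F) \<longleftrightarrow>
     (\<forall>t\<in>F. \<forall>s\<in>faces R. sle s t \<longrightarrow> s \<in> F)"
  proof -
    have "(cell_le (face_set R s) (face_set R t) \<longrightarrow> face_set R s \<in> face_set R ` F) \<longleftrightarrow> (sle s t \<longrightarrow> s \<in> F)"
      if "t \<in> F" "s \<in> faces R" for s t
      using cell_le_face[of s t] mem[of s] F that by blast
    then show ?thesis unfolding complex_eq by simp
  qed
  moreover have "(\<forall>A\<in>face_set R ` F. \<forall>B\<in>face_set R ` F. cell_prod \<Phi> A B \<in> face_set R ` F) \<longleftrightarrow>
     (\<forall>s\<in>F. \<forall>t\<in>F. smul s t \<in> F)"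
  proof -
    have "cell_prod \<Phi> (face_set R s) (face_set R t) \<in> face_set R ` F \<longleftrightarrow> smul s t \<in> F"
      if "s \<in> F" "t \<in> F" for s t
    proof -
      have st: "s \<in> faces R" "t \<in> faces R" using F that by auto
      show ?thesis unfolding cell_prod_face[OF st] by (rule mem[OF faces_smul[OF st]])
    qed
    then show ?thesis by simp
  qed
  ultimately show ?thesis unfolding convex_subcomplex_def subcomplex_def using sub by simp
qed

lemma convex_induced_iff:
  "convex_subcomplex \<Phi> (induced_subcomplex \<Phi> D) \<longleftrightarrow>
    (\<forall>s\<in>full_faces R D. \<forall>t\<in>full_faces R D. smul s t \<in> full_faces R D)"
proof -
  have "full_faces R D \<subseteq> faces R" unfolding full_faces_def by blast
  from convex_subcomplex_face[OF this] show ?thesis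
    unfolding induced_eq using szero_full_face full_faces_below by blast
qed

lemma singleton_face: "{v} \<in> face_set R ` F \<longleftrightarrow> v \<in> verts R \<and> sv R v \<in> F" if "F \<subseteq> faces R"
proof
  assume "{v} \<in> face_set R ` F"
  then obtain s where s: "s \<in> F" "face_set R s = {v}" by (metis imageE)
  then have "v \<in> face_set R s" by simp
  then have "s = sv R v" unfolding face_set_def by simp
  then show "v \<in> verts R \<and> sv R v \<in> F" using s face_set_sv by (simp add: verts_def)
next
  assume "v \<in> verts R \<and> sv R v \<in> F"
  then have "{v} = face_set R (sv R v)" "sv R v \<in> F" using face_set_sv by (simp_all add: verts_def)
  then show "{v} \<in> face_set R ` F" by (rule image_eqI)
qed

lemma L_convex_iff:
  assumes D: "D \<noteq> {}" "D \<subseteq> verts R"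
  shows "L_convex \<Phi> D \<longleftrightarrow> convex_subcomplex \<Phi> (induced_subcomplex \<Phi> D)"
proof
  assume "L_convex \<Phi> D"
  then obtain X where X: "convex_subcomplex \<Phi> X" "D = {v. {v} \<in> X}" unfolding L_convex_def by blast
  then have "X \<subseteq> face_set R ` faces R"
    unfolding convex_subcomplex_def subcomplex_def complex_eq by blast
  then obtain F where F: "F \<subseteq> faces R" "X = face_set R ` F" by (meson subset_imageE)
  have "D = {v \<in> verts R. sv R v \<in> F}" using X(2) singleton_face[OF F(1)] F(2) by blast
  moreover have "F \<noteq> {}" "\<forall>t\<in>F. \<forall>s\<in>faces R. sle s t \<longrightarrow> s \<in> F" "\<forall>s\<in>F. \<forall>t\<in>F. smul s t \<in> F"
    using X(1) convex_subcomplex_face[OF F(1)] F(2) by simp_all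
  ultimately have "F = full_faces R D" using closed_family_eq_full_faces[OF F(1)] by blast
  then show "convex_subcomplex \<Phi> (induced_subcomplex \<Phi> D)" using X(1) F(2) induced_eq by simp
next
  assume c: "convex_subcomplex \<Phi> (induced_subcomplex \<Phi> D)"
  have "D = {v. {v} \<in> induced_subcomplex \<Phi> D}"
  proof -
    have ff: "full_faces R D \<subseteq> faces R" unfolding full_faces_def by blast
    have "v \<in> D" if "v \<in> verts R" "sv R v \<in> full_faces R D" for v
      using that sle_refl unfolding full_faces_def by blast
    moreover have "v \<in> verts R \<and> sv R v \<in> full_faces R D" if "v \<in> D" for v
      using vertex_full_face[OF that D(2)] D(2) that by blast
    ultimately show ?thesis unfolding induced_eq singleton_face[OF ff] by blast
  qed
  then show "L_convex \<Phi> D" unfolding L_convex_def vertices_eq using D c by blast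
qed

lemma midpoint_iff:
  "(\<forall>x\<in>D. \<forall>y\<in>D. cell_vertices (cell_at \<Phi> ((1/2) *\<^sub>R (x + y))) \<subseteq> D) \<longleftrightarrow> midpoint_closed R D"
proof -
  have "cell_vertices (cell_at \<Phi> x) = {v \<in> verts R. sle (sv R v) (sv R x)}" for x
    unfolding cell_at_eq by (rule cell_vertices_face) (simp add: faces_def)
  then show ?thesis unfolding midpoint_closed_def by (simp only: subset_iff mem_Collect_eq) blast
qed

lemma convex_imp_midpoint_closed:
  assumes "D \<subseteq> verts R" "convex (lovasz_extension \<Phi> D)"
  shows "midpoint_closed R D"
  unfolding midpoint_closed_def
proof (intro ballI impI)
  fix x y v assume xy: "x \<in> D" "y \<in> D" and v: "v \<in> verts R" "sle (sv R v) (sv R ((1/2) *\<^sub>R (x + y)))"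
  have "x \<in> lovasz_extension \<Phi> D" "y \<in> lovasz_extension \<Phi> D"
    using vertex_full_face assms(1) xy by (simp_all add: lovasz_eq)
  then have "(1/2) *\<^sub>R x + (1/2) *\<^sub>R y \<in> lovasz_extension \<Phi> D"
    using assms(2) by (intro convexD) auto
  then have "sv R ((1/2) *\<^sub>R (x + y)) \<in> full_faces R D" by (simp add: lovasz_eq scaleR_add_right)
  then show "v \<in> D" using v unfolding full_faces_def by blast
qed

end

section \<open>Characterizations of L-convex sets\<close>

theorem theorem7p1:
  fixes \<Phi> :: "('a::euclidean_space \<Rightarrow>\<^sub>L real) set" and D :: "'a set"
  assumes "root_system \<Phi>" and "essential \<Phi>" and "irreducible_roots \<Phi>"
    and "classical_type \<Phi>"
    and "D \<noteq> {}" and "D \<subseteq> vertices \<Phi>"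
  shows "(L_convex \<Phi> D \<longleftrightarrow> convex_subcomplex \<Phi> (induced_subcomplex \<Phi> D)) \<and>
         (convex_subcomplex \<Phi> (induced_subcomplex \<Phi> D) \<longleftrightarrow> convex (lovasz_extension \<Phi> D)) \<and>
         (convex (lovasz_extension \<Phi> D) \<longleftrightarrow>
            (\<forall>x\<in>D. \<forall>y\<in>D. cell_vertices (cell_at \<Phi> ((1/2) *\<^sub>R (x + y))) \<subseteq> D))"
proof -
  interpret ra: root_arrangement "riesz ` \<Phi>" using root_arrangement_riesz assms by blast
  interpret coxeter_roots "riesz ` \<Phi>" \<Phi>
    using ra.root_opposite_wall classical_half_integral[OF assms(1-4)] by unfold_locales auto
  have D: "D \<noteq> {}" "D \<subseteq> verts (riesz ` \<Phi>)" using assms vertices_eq by auto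
  have "convex (lovasz_extension \<Phi> D)" if "convex_subcomplex \<Phi> (induced_subcomplex \<Phi> D)"
    using that convex_full_faces unfolding convex_induced_iff lovasz_eq by blast
  moreover have "convex_subcomplex \<Phi> (induced_subcomplex \<Phi> D)" if "midpoint_closed (riesz ` \<Phi>) D"
    using full_faces_closed[OF D(2) that] unfolding convex_induced_iff by blast
  ultimately show ?thesis
    using L_convex_iff[OF D] midpoint_iff convex_imp_midpoint_closed[OF D(2)] by blast
qed

end
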